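(* There is a bijection between the $s$–$d$ paths of the graph $\mathcal G(V,E)$ below and the strategies in $\overline{\mathcal P}_{\le m}$: the path $s\to(1,z_1)\to\dots\to(k,z_k)\to d$ ($k\in[m]$) corresponds to $\mathbf b=\langle(b_1,q_1),\dots,(b_k,q_k)\rangle$ with $b_\ell=w_{z_\ell}$ and $q_\ell=z_\ell-z_{\ell-1}$ ($z_0=0$), and conversely $\langle(w_{Q_1},q_1),\dots,(w_{Q_k},q_k)\rangle$ corresponds to $s\to(1,Q_1)\to\dots\to(k,Q_k)\to d$. The total value $\sum_{t=1}^T V(\mathbf b;\boldsymbol\beta_-^t)$ of a strategy equals the weight of its corresponding path. Consequently, computing $\max_{\mathbf b\in\overline{\mathcal P}_{\le m}}\sum_{t=1}^TV(\mathbf b;\boldsymbol\beta_-^t)$ is equivalent to finding a maximum weight $s$–$d$ path in $\mathcal G(V,E)$, which can be done in time polynomial in $m$ and $M$.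
   Context: A uniform price auction selling $K$ identical units is repeated over $t\in[T]$ with known competing bids $\boldsymbol\beta_-^t$. A bidder has valuation $v_1\ge\dots\ge v_M>0$ ($M\le K$), $w_j=\frac1j\sum_{\ell\le j}v_\ell$. An $m$-uniform strategy $\langle(b_1,q_1),\dots,(b_m,q_m)\rangle$ has $b_1>\dots>b_m>0$, positive integers $q_j$, $Q_j=\sum_{\ell\le j}q_\ell\le M$, and stands for the bid vector with $q_1$ copies of $b_1$, then $q_2$ copies of $b_2$, etc. In each round the $K$ highest bids win a unit each (ties in favor of the bidder), $x$ is the number of the bidder's winning bids, $V(\mathbf b;\boldsymbol\beta_-^t)=\sum_{j\le x}v_j$. $\beta_-^{t,-(k)}$ is the $k$-th smallest among the top $K$ competing bids of round $t$. $\overline{\mathcal P}_{\le m}$ is the set of $k$-uniform strategies, $k\in[m]$, with $b_\ell=w_{Q_\ell}$ for all $\ell$. The directed graph $\mathcal G(V,E)$ has source $s=(0,0)$, destination $d$, and for each $\ell\in[m]$ the nodes $(\ell,j)$, $j\in\{\ell,\dots,M\}$. Edges: $(\ell-1,j)\to(\ell,j')$ for all $\ell\in[m]$ and $j<j'$ (with $(0,0)=s$), of weight $\sum_{t=1}^T\sum_{k=j+1}^{j'}v_k\,\mathbf 1\{w_{j'}\ge\beta_-^{t,-(k)}\}$; and $(\ell,j)\to d$ for all $\ell\in[m]$, of weight $0$.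
   Formalization: If some averages w_j coincide (e.g. v_1=v_2, m≥2), a path may give equal bids, so the bijection fails; it is proved onto strategies with b_1≥…≥b_k, and onto the strict ones exactly when m=1 or w_1,…,w_M are distinct. *)

theory Defs
  imports Complex_Main "Graph_Theory.Graph_Theory"
begin

section \<open>Uniform price auction\<close>

text \<open>Positions are 1-based: the valuation is \<open>v 1, \<dots>, v M\<close> and rounds are \<open>1, \<dots>, T\<close>.
  Bid vectors are lists, and \<open>B t\<close> lists the competing bids of round \<open>t\<close>.\<close>

definition avg :: "(nat \<Rightarrow> real) \<Rightarrow> nat \<Rightarrow> real" where
  "avg v j = (\<Sum>l = 1..j. v l) / real j"

definition kth_threshold :: "nat \<Rightarrow> real list \<Rightarrow> nat \<Rightarrow> real" where
  "kth_threshold K B k = sort (take K (rev (sort B))) ! (k - 1)"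

text \<open>Every bid carries a flag telling whether it is the bidder's own. Sorting is stable and own
  bids are listed first, so ties are resolved in favour of the bidder.\<close>

definition ranked_bids :: "real list \<Rightarrow> real list \<Rightarrow> (real \<times> bool) list" where
  "ranked_bids b B =
     sort_key (\<lambda>x. - fst x) (map (\<lambda>x. (x, True)) b @ map (\<lambda>x. (x, False)) B)"

definition units_won :: "nat \<Rightarrow> real list \<Rightarrow> real list \<Rightarrow> nat" where
  "units_won K b B = length (filter snd (take K (ranked_bids b B)))"

definition round_value :: "nat \<Rightarrow> (nat \<Rightarrow> real) \<Rightarrow> real list \<Rightarrow> real list \<Rightarrow> real" where
  "round_value K v b B = (\<Sum>j = 1..units_won K b B. v j)"

section \<open>Uniform strategies\<close>

type_synonym strategy = "(real \<times> nat) list"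

definition bid_vector :: "strategy \<Rightarrow> real list" where
  "bid_vector xs = concat (map (\<lambda>(b, q). replicate q b) xs)"

definition cum_quantity :: "strategy \<Rightarrow> nat \<Rightarrow> nat" where
  "cum_quantity xs l = sum_list (map snd (take l xs))"

text \<open>The order \<open>R\<close> is \<open>(>)\<close> for uniform strategies proper. With \<open>(\<ge>)\<close> consecutive equal bid
  values may be listed separately; this matters only if some of the averages \<open>avg v j\<close>
  coincide.\<close>

definition uniform_strategy :: "(real \<Rightarrow> real \<Rightarrow> bool) \<Rightarrow> nat \<Rightarrow> nat \<Rightarrow> strategy \<Rightarrow> bool" where
  "uniform_strategy R M k xs \<longleftrightarrow>
     length xs = k \<and> sorted_wrt R (map fst xs) \<and>
     (\<forall>(b, q) \<in> set xs. b > 0 \<and> q > 0) \<and> cum_quantity xs k \<le> M"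

definition avg_strategies ::
    "(real \<Rightarrow> real \<Rightarrow> bool) \<Rightarrow> (nat \<Rightarrow> real) \<Rightarrow> nat \<Rightarrow> nat \<Rightarrow> strategy set" where
  "avg_strategies R v M m =
     {xs. \<exists>k \<in> {1..m}. uniform_strategy R M k xs \<and>
          (\<forall>l \<in> {1..k}. fst (xs ! (l - 1)) = avg v (cum_quantity xs l))}"

definition Pbar :: "(nat \<Rightarrow> real) \<Rightarrow> nat \<Rightarrow> nat \<Rightarrow> strategy set" where
  "Pbar = avg_strategies (>)"

definition Pbar_weak :: "(nat \<Rightarrow> real) \<Rightarrow> nat \<Rightarrow> nat \<Rightarrow> strategy set" where
  "Pbar_weak = avg_strategies (\<ge>)"

definition total_value ::
    "nat \<Rightarrow> nat \<Rightarrow> (nat \<Rightarrow> real) \<Rightarrow> (nat \<Rightarrow> real list) \<Rightarrow> strategy \<Rightarrow> real" where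
  "total_value K T v B xs = (\<Sum>t = 1..T. round_value K v (bid_vector xs) (B t))"

section \<open>The layered graph\<close>

datatype node = Layer nat nat | Dest

type_synonym edge = "node \<times> node"

definition nodes :: "nat \<Rightarrow> nat \<Rightarrow> node set" where
  "nodes M m = {Layer 0 0, Dest} \<union> {Layer l j | l j. l \<in> {1..m} \<and> j \<in> {l..M}}"

definition auction_graph :: "nat \<Rightarrow> nat \<Rightarrow> (node, edge) pre_digraph" where
  "auction_graph M m =
     \<lparr> verts = nodes M m,
       arcs = {(Layer (l - 1) j, Layer l j') | l j j'. l \<in> {1..m} \<and> j < j' \<and>
                 Layer (l - 1) j \<in> nodes M m \<and> Layer l j' \<in> nodes M m}
            \<union> {(Layer l j, Dest) | l j. l \<in> {1..m} \<and> Layer l j \<in> nodes M m},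
       tail = fst, head = snd \<rparr>"

definition sd_paths :: "nat \<Rightarrow> nat \<Rightarrow> edge list set" where
  "sd_paths M m = {p. pre_digraph.apath (auction_graph M m) (Layer 0 0) p Dest}"

fun edge_weight ::
    "nat \<Rightarrow> nat \<Rightarrow> (nat \<Rightarrow> real) \<Rightarrow> (nat \<Rightarrow> real list) \<Rightarrow> edge \<Rightarrow> real" where
  "edge_weight K T v B (Layer _ j, Layer _ j') =
     (\<Sum>t = 1..T. \<Sum>k = j + 1..j'. v k * of_bool (avg v j' \<ge> kth_threshold K (B t) k))"
| "edge_weight K T v B (_, Dest) = 0"
| "edge_weight K T v B (Dest, _) = 0"

abbreviation path_weight :: "(edge \<Rightarrow> real) \<Rightarrow> edge list \<Rightarrow> real" where
  "path_weight \<equiv> wf_digraph.awalk_cost"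

definition layer_path :: "(nat \<Rightarrow> nat) \<Rightarrow> nat \<Rightarrow> edge list" where
  "layer_path z k =
     map (\<lambda>l. (Layer (l - 1) (z (l - 1)), Layer l (z l))) [1..<k + 1] @ [(Layer k (z k), Dest)]"

definition strategy_path :: "strategy \<Rightarrow> edge list" where
  "strategy_path xs = layer_path (cum_quantity xs) (length xs)"

definition path_pos :: "edge list \<Rightarrow> nat \<Rightarrow> nat" where
  "path_pos p l = (if l = 0 then 0 else case snd (p ! (l - 1)) of Layer _ j \<Rightarrow> j | Dest \<Rightarrow> 0)"

definition path_strategy :: "(nat \<Rightarrow> real) \<Rightarrow> edge list \<Rightarrow> strategy" where
  "path_strategy v p =
     map (\<lambda>l. (avg v (path_pos p l), path_pos p l - path_pos p (l - 1))) [1..<length p]"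

section \<open>A unit-cost machine model\<close>

text \<open>A while language over arrays of natural numbers and arrays of reals, in the style of the
  real RAM; a scalar variable is entry 0 of an array. The edge weights are a read-only input
  accessed by \<open>Weight\<close>; edges into \<open>Dest\<close> are not read, as they have weight 0. There is no
  multiplication, so the bit length of natural numbers grows by O(1) per step and
  unit costs are polynomially related to bit costs. Every assignment, test and \<open>Skip\<close> costs 1; the
  expressions in it only contribute a constant factor depending on the program.\<close>

datatype nexp =
    Num nat
  | NArr string nexp
  | NAdd nexp nexp
  | NSub nexp nexp

datatype rexp =
    Zero
  | RArr string nexp
  | RAdd rexp rexp
  | Weight nexp nexp nexp

datatype test = NLess nexp nexp | RLess rexp rexp

datatype com =
    Skip
  | NAssign string nexp nexp
  | RAssign string nexp rexp
  | Seq com com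
  | Cond test com com
  | While test com

type_synonym nstore = "string \<Rightarrow> nat \<Rightarrow> nat"
type_synonym rstore = "string \<Rightarrow> nat \<Rightarrow> real"
type_synonym state = "nstore \<times> rstore"

fun nval :: "nstore \<Rightarrow> nexp \<Rightarrow> nat" where
  "nval N (Num n) = n"
| "nval N (NArr x e) = N x (nval N e)"
| "nval N (NAdd e f) = nval N e + nval N f"
| "nval N (NSub e f) = nval N e - nval N f"

fun rval :: "(edge \<Rightarrow> real) \<Rightarrow> state \<Rightarrow> rexp \<Rightarrow> real" where
  "rval w s Zero = 0"
| "rval w s (RArr x e) = snd s x (nval (fst s) e)"
| "rval w s (RAdd e f) = rval w s e + rval w s f"
| "rval w s (Weight l j j') =
     w (Layer (nval (fst s) l) (nval (fst s) j), Layer (nval (fst s) l + 1) (nval (fst s) j'))"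

fun holds :: "(edge \<Rightarrow> real) \<Rightarrow> state \<Rightarrow> test \<Rightarrow> bool" where
  "holds w s (NLess e f) \<longleftrightarrow> nval (fst s) e < nval (fst s) f"
| "holds w s (RLess e f) \<longleftrightarrow> rval w s e < rval w s f"

definition upd :: "(string \<Rightarrow> nat \<Rightarrow> 'a) \<Rightarrow> string \<Rightarrow> nat \<Rightarrow> 'a \<Rightarrow> string \<Rightarrow> nat \<Rightarrow> 'a" where
  "upd f x i a = f(x := (f x)(i := a))"

text \<open>\<open>exec w c s n s'\<close>: started in \<open>s\<close>, the program \<open>c\<close> terminates in \<open>s'\<close> after \<open>n\<close> steps.\<close>

inductive exec :: "(edge \<Rightarrow> real) \<Rightarrow> com \<Rightarrow> state \<Rightarrow> nat \<Rightarrow> state \<Rightarrow> bool"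
  for w :: "edge \<Rightarrow> real" where
  Skip: "exec w Skip s 1 s"
| NAssign: "exec w (NAssign x i e) (N, R) 1 (upd N x (nval N i) (nval N e), R)"
| RAssign: "exec w (RAssign x i e) (N, R) 1 (N, upd R x (nval N i) (rval w (N, R) e))"
| Seq: "exec w c s n s' \<Longrightarrow> exec w d s' n' s'' \<Longrightarrow> exec w (Seq c d) s (n + n') s''"
| CondTrue: "holds w s b \<Longrightarrow> exec w c s n s' \<Longrightarrow> exec w (Cond b c d) s (n + 1) s'"
| CondFalse: "\<not> holds w s b \<Longrightarrow> exec w d s n s' \<Longrightarrow> exec w (Cond b c d) s (n + 1) s'"
| WhileFalse: "\<not> holds w s b \<Longrightarrow> exec w (While b c) s 1 s"
| WhileTrue: "holds w s b \<Longrightarrow> exec w c s n s' \<Longrightarrow> exec w (While b c) s' n' s'' \<Longrightarrow>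
    exec w (While b c) s (n + n' + 1) s''"

definition input_state :: "nat \<Rightarrow> nat \<Rightarrow> state" where
  "input_state M m = (upd (upd (\<lambda>_ _. 0) ''M'' 0 M) ''m'' 0 m, \<lambda>_ _. 0)"

text \<open>A path \<open>(0,0) \<rightarrow> (1,z 1) \<rightarrow> \<dots> \<rightarrow> (k,z k) \<rightarrow> d\<close> is output as the number \<open>k\<close> and the array \<open>z\<close>
  with \<open>z 0 = 0\<close>.\<close>

definition output_path :: "state \<Rightarrow> edge list" where
  "output_path s = layer_path (fst s ''z'') (fst s ''k'' 0)"

end

(* A path s -> (1, z 1) -> ... -> (k, z k) -> d is the same thing as an increasing sequence
   0 = z 0 < z 1 < ... < z k <= M, and so is a strategy with q_l = z l - z (l - 1) whose l-th bid is the
   average at z l; averages of a nonincreasing valuation are nonincreasing, so the bids come in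
   weakly decreasing order. Equal consecutive bids can be merged without changing the bid vector, which
   reduces proper uniform strategies to weak ones.

   The k-th own bid wins iff at most K - k competing bids are strictly larger, i.e. iff it reaches
   the k-th smallest among the top K competing bids. Summing v k over these k and grouping the k by
   the blocks (z (l - 1), z l] of constant bid gives the edge weights.

   A heaviest path is found by dynamic programming from the last layer towards the source,
   followed by reading off the recorded successors from the source onwards. *)

theory Submission
  imports Defs
begin

section \<open>Paths of the layered graph\<close>

text \<open>The obstacle is a tie between averages. For nonincreasing \<open>v\<close>, two averages
  coincide only if \<open>v\<close> is constant up to the larger position, so for \<open>M\<close>
  at least 2 ties exist exactly when \<open>v 1 = v 2\<close>. A path through two tied positions
  gives two blocks at the same price, which strictly decreasing bids exclude; this is why the
  bijection goes to \<open>Pbar_weak\<close>. Maximization over \<open>Pbar\<close> loses nothing: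
  merging never adds a block, so the bound \<open>m\<close> survives. Maxima are therefore
  transferred through the sets of attained values and not through a bijection.

  The dynamic program runs backwards so that it records successors, which can be read in the order
  in which the output array \<open>z\<close> is filled; recorded predecessors would yield the path
  in reverse. Loops over layers, nodes and successors are nested, hence the cubic bound.\<close>

lemma arcs_auction_graph: "arcs (auction_graph M m) \<subseteq> nodes M m \<times> nodes M m"
proof -
  have "Dest \<in> nodes M m"
    by (simp add: nodes_def)
  then show ?thesis
    by (auto simp: auction_graph_def)
qed

lemma wf_auction_graph: "wf_digraph (auction_graph M m)"
proof
  fix e assume "e \<in> arcs (auction_graph M m)"
  then have "fst e \<in> nodes M m \<and> snd e \<in> nodes M m"
    using arcs_auction_graph by (metis mem_Times_iff subsetD)
  then show "tail (auction_graph M m) e \<in> verts (auction_graph M m)"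
    and "head (auction_graph M m) e \<in> verts (auction_graph M m)"
    by (simp_all add: auction_graph_def)
qed

lemma finite_nodes: "finite (nodes M m)"
proof -
  have "nodes M m \<subseteq> {Layer 0 0, Dest} \<union> (\<lambda>(l, j). Layer l j) ` ({1..m} \<times> {..M})"
    by (auto simp: nodes_def)
  then show ?thesis
    by (rule finite_subset) auto
qed

lemma fin_auction_graph: "fin_digraph (auction_graph M m)"
proof -
  interpret wf_digraph "auction_graph M m"
    by (rule wf_auction_graph)
  have "finite (arcs (auction_graph M m))"
    by (rule finite_subset[OF arcs_auction_graph]) (simp add: finite_nodes)
  then show ?thesis
    by unfold_locales (simp_all add: auction_graph_def finite_nodes)
qed

lemma finite_sd_paths: "finite (sd_paths M m)"
  unfolding sd_paths_def by (rule fin_digraph.apaths_finite[OF fin_auction_graph])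

lemma path_weight_eq: "path_weight f es = sum_list (map f es)"
  by (rule wf_digraph.awalk_cost_def[OF wf_auction_graph])

text \<open>Nothing is required beyond index \<open>k\<close>, so one path comes from many functions
  \<open>z\<close>; \<open>layer_path_cong\<close> identifies them.\<close>

definition positions :: "nat \<Rightarrow> nat \<Rightarrow> (nat \<Rightarrow> nat) \<Rightarrow> bool" where
  "positions M k z \<longleftrightarrow> z 0 = 0 \<and> (\<forall>l<k. z l < z (Suc l)) \<and> z k \<le> M"

lemma positions_less: "positions M k z \<Longrightarrow> l < k \<Longrightarrow> z l < z (Suc l)"
  by (simp add: positions_def)

lemma positions_mono:
  assumes "positions M k z" and "i \<le> j" and "j \<le> k"
  shows "z i \<le> z j"
  using assms(2,3)
proof (induction j rule: dec_induct)
  case (step n)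
  then show ?case
    using positions_less[OF assms(1), of n] by simp
qed simp

lemma positions_le:
  assumes "positions M k z" and "l \<le> k"
  shows "z l \<le> M"
  using positions_mono[OF assms order_refl] assms(1) by (simp add: positions_def)

text \<open>This accounts for the lower bound on \<open>j\<close> in the nodes of layer
  \<open>l\<close>: a strictly increasing sequence of naturals starting at 0 is never behind the
  identity.\<close>

lemma positions_ge:
  assumes "positions M k z" and "l \<le> k"
  shows "l \<le> z l"
  using assms(2)
proof (induction l)
  case (Suc l)
  then show ?case
    using positions_less[OF assms(1), of l] by simp
qed simp

lemma layer_path_cong: "(\<And>l. l \<le> k \<Longrightarrow> z l = z' l) \<Longrightarrow> layer_path z k = layer_path z' k"
  by (auto simp: layer_path_def)

lemma length_layer_path [simp]: "length (layer_path z k) = Suc k"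
  by (simp add: layer_path_def)

lemma path_pos_layer_path:
  assumes "z 0 = 0" and "l \<le> k"
  shows "path_pos (layer_path z k) l = z l"
  using assms le_less[of l k] by (auto simp: path_pos_def layer_path_def nth_append)

text \<open>The tail \<open>p\<close> is arbitrary so that, in the induction on \<open>k\<close>,
  the newly appended layer edge can be moved into it.\<close>

lemma cas_layers:
  "pre_digraph.cas (auction_graph M m) (Layer 0 (z 0))
     (map (\<lambda>l. (Layer (l - 1) (z (l - 1)), Layer l (z l))) [1..<k + 1] @ p) u \<longleftrightarrow>
   pre_digraph.cas (auction_graph M m) (Layer k (z k)) p u"
proof (induction k arbitrary: p)
  case (Suc k)
  then show ?case
    by (simp add: pre_digraph.cas.simps, simp add: auction_graph_def)
qed simp

lemma layer_path_in_sd_paths: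
  assumes "1 \<le> k" and "k \<le> m" and z: "positions M k z"
  shows "layer_path z k \<in> sd_paths M m"
proof -
  let ?G = "auction_graph M m"
  let ?p = "layer_path z k"
  have z0: "z 0 = 0"
    using z by (simp add: positions_def)
  have node: "Layer l (z l) \<in> nodes M m" if "l \<le> k" for l
    using that z0 assms(2) positions_le[OF z that] positions_ge[OF z that]
    by (cases l) (auto simp: nodes_def)
  have "set ?p \<subseteq> arcs ?G"
  proof
    fix e assume "e \<in> set ?p"
    then have "e \<in> (\<lambda>l. (Layer (l - 1) (z (l - 1)), Layer l (z l))) ` Suc ` {..<k} \<or>
        e = (Layer k (z k), Dest)"
      by (auto simp: layer_path_def image_Suc_lessThan simp del: upt_Suc)
    then consider l where "l < k" "e = (Layer l (z l), Layer (Suc l) (z (Suc l)))"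
      | "e = (Layer k (z k), Dest)"
      by force
    then show "e \<in> arcs ?G"
    proof cases
      case 1
      then have "Layer (Suc l - 1) (z l) \<in> nodes M m" "Layer (Suc l) (z (Suc l)) \<in> nodes M m"
        "z l < z (Suc l)" "Suc l \<in> {1..m}"
        using node[of l] node[of "Suc l"] z assms(2) by (auto simp: positions_def)
      then show ?thesis
        using 1(2) unfolding auction_graph_def by fastforce
    next
      case 2
      then show ?thesis
        using node[of k] assms by (auto simp: auction_graph_def)
    qed
  qed
  moreover have "pre_digraph.cas ?G (Layer 0 0) ?p Dest"
    using cas_layers[of M m z k] z0
    by (simp add: layer_path_def pre_digraph.cas.simps, simp add: auction_graph_def)
  moreover have "Layer 0 0 \<in> verts ?G"
    by (simp add: auction_graph_def nodes_def)
  moreover have "distinct (pre_digraph.awalk_verts ?G (Layer 0 0) ?p)"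
  proof -
    have "pre_digraph.awalk_verts ?G (Layer 0 0) ?p = map (tail ?G) ?p @ [head ?G (last ?p)]"
      by (subst pre_digraph.awalk_verts_conv) (simp add: layer_path_def)
    also have "\<dots> = map (\<lambda>l. Layer (l - 1) (z (l - 1))) [1..<k + 1] @ [Layer k (z k), Dest]"
      by (simp add: layer_path_def auction_graph_def)
    \<comment> \<open>The layer numbers alone keep the vertices apart.\<close>
    also have "distinct \<dots>"
      by (auto simp: distinct_map inj_on_def)
    finally show ?thesis .
  qed
  ultimately show ?thesis
    by (simp add: sd_paths_def pre_digraph.apath_def pre_digraph.awalk_def)
qed

text \<open>The start node is arbitrary because the induction strips the first edge and continues
  one layer further. Every edge either raises the layer by one or enters \<open>Dest\<close>, so the
  shape is forced; \<open>k\<close> is positive because the source has no edge into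
  \<open>Dest\<close>.\<close>

lemma walk_from_layer:
  assumes "set p \<subseteq> arcs (auction_graph M m)"
    and "pre_digraph.cas (auction_graph M m) (Layer l j) p Dest" and "j \<le> M"
  shows "\<exists>k z. l \<le> k \<and> 1 \<le> k \<and> k \<le> m \<and> z l = j \<and> (\<forall>i. l \<le> i \<and> i < k \<longrightarrow> z i < z (Suc i)) \<and>
    z k \<le> M \<and> p = map (\<lambda>i. (Layer (i - 1) (z (i - 1)), Layer i (z i))) [Suc l..<Suc k]
      @ [(Layer k (z k), Dest)]"
  using assms
proof (induction p arbitrary: l j)
  case Nil
  then show ?case
    by (simp add: pre_digraph.cas.simps)
next
  case (Cons e p)
  obtain h where e: "e = (Layer l j, h)"
    using Cons.prems(2) by (cases e) (simp add: pre_digraph.cas.simps, simp add: auction_graph_def)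
  have p: "pre_digraph.cas (auction_graph M m) h p Dest"
    using Cons.prems(2) by (simp add: pre_digraph.cas.simps, simp add: auction_graph_def e)
  have arc: "(Layer l j, h) \<in> arcs (auction_graph M m)"
    using Cons.prems(1) by (simp add: e)
  show ?case
  proof (cases h)
    case (Layer l' j')
    then have l': "l' = Suc l" and jj: "j < j'" "j' \<le> M"
      using arc by (auto simp: auction_graph_def nodes_def)
    from Cons.IH[of "Suc l" j'] p Cons.prems(1) jj(2)
    obtain k z where kz: "Suc l \<le> k" "k \<le> m" "z (Suc l) = j'"
        "\<And>i. Suc l \<le> i \<Longrightarrow> i < k \<Longrightarrow> z i < z (Suc i)" "z k \<le> M"
        "p = map (\<lambda>i. (Layer (i - 1) (z (i - 1)), Layer i (z i))) [Suc (Suc l)..<Suc k]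
           @ [(Layer k (z k), Dest)]"
      unfolding Layer l' by auto
    \<comment> \<open>The sequence for the remaining walk matters only from \<open>Suc l\<close> on,
      so its value at \<open>l\<close> is free.\<close>
    let ?z = "z(l := j)"
    have "map (\<lambda>i. (Layer (i - 1) (?z (i - 1)), Layer i (?z i))) [Suc l..<Suc k] =
      (Layer l j, Layer (Suc l) j') #
      map (\<lambda>i. (Layer (i - 1) (z (i - 1)), Layer i (z i))) [Suc (Suc l)..<Suc k]"
      using kz(1,3) by (subst upt_conv_Cons) (auto simp del: upt_Suc)
    then have "e # p = map (\<lambda>i. (Layer (i - 1) (?z (i - 1)), Layer i (?z i))) [Suc l..<Suc k]
        @ [(Layer k (?z k), Dest)]"
      using kz(1) by (simp only: kz(6) e Layer l') simp
    moreover have "?z i < ?z (Suc i)" if "l \<le> i" "i < k" for i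
      using that kz(3) kz(4)[of i] jj(1) by (cases "i = l") auto
    moreover have "?z k \<le> M"
      using kz(1,5) by simp
    ultimately show ?thesis
      using kz(1,2) by (intro exI[of _ k] exI[of _ ?z] conjI) (auto simp del: upt_Suc)
  next
    case Dest
    \<comment> \<open>\<open>Dest\<close> has no outgoing arc.\<close>
    have "p = []"
    proof (cases p)
      case (Cons e' p')
      then show ?thesis
        using p Dest Cons.prems(1)
        by (simp add: pre_digraph.cas.simps, simp add: auction_graph_def) auto
    qed
    then show ?thesis
      using arc Cons.prems(3) unfolding e Dest
      by (intro exI[of _ l] exI[of _ "\<lambda>_. j"]) (auto simp: auction_graph_def)
  qed
qed

lemma sd_paths_eq: "sd_paths M m = {layer_path z k | z k. 1 \<le> k \<and> k \<le> m \<and> positions M k z}"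
proof (intro equalityI subsetI)
  fix p assume "p \<in> sd_paths M m"
  then have "set p \<subseteq> arcs (auction_graph M m)"
    "pre_digraph.cas (auction_graph M m) (Layer 0 0) p Dest"
    by (auto simp: sd_paths_def pre_digraph.apath_def pre_digraph.awalk_def)
  from walk_from_layer[OF this] obtain k z where "1 \<le> k" "k \<le> m" "positions M k z" "p = layer_path z k"
    unfolding layer_path_def positions_def by auto
  then show "p \<in> {layer_path z k | z k. 1 \<le> k \<and> k \<le> m \<and> positions M k z}"
    by blast
qed (auto intro: layer_path_in_sd_paths)

lemma sd_paths_nonempty:
  assumes "1 \<le> M" and "1 \<le> m"
  shows "sd_paths M m \<noteq> {}"
  using layer_path_in_sd_paths[of 1 m M "\<lambda>l. l"] assms by (auto simp: positions_def)

section \<open>Paths and strategies\<close>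

lemma cum_quantity_0 [simp]: "cum_quantity xs 0 = 0"
  by (simp add: cum_quantity_def)

lemma cum_quantity_Suc:
  "l < length xs \<Longrightarrow> cum_quantity xs (Suc l) = cum_quantity xs l + snd (xs ! l)"
  by (simp add: cum_quantity_def take_Suc_conv_app_nth)

text \<open>Antitonicity of the averages with denominators cleared: the terms after position
  \<open>i\<close> are at most \<open>v i\<close>, which is at most the mean of the first
  \<open>i\<close> terms.\<close>

lemma sum_mult_le_sum_mult:
  fixes v :: "nat \<Rightarrow> real"
  assumes dec: "\<forall>i j. 1 \<le> i \<and> i \<le> j \<and> j \<le> M \<longrightarrow> v j \<le> v i"
    and "1 \<le> i" and "i \<le> j" and "j \<le> M"
  shows "(\<Sum>l = 1..j. v l) * real i \<le> (\<Sum>l = 1..i. v l) * real j"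
proof -
  have S: "real i * v i \<le> (\<Sum>l = 1..i. v l)"
    using sum_bounded_below[of "{1..i}" "v i" v] assms by simp
  have "(\<Sum>l = 1..j. v l) = (\<Sum>l = 1..i. v l) + (\<Sum>l = i + 1..j. v l)"
    using assms(3) sum.ub_add_nat[of 1 i v "j - i"] by simp
  also have "(\<Sum>l = i + 1..j. v l) \<le> real (j - i) * v i"
    using sum_bounded_above[of "{i + 1..j}" v "v i"] assms by simp
  finally have "(\<Sum>l = 1..j. v l) * real i
      \<le> ((\<Sum>l = 1..i. v l) + real (j - i) * v i) * real i"
    by (simp add: mult_right_mono)
  also have "\<dots> \<le> (\<Sum>l = 1..i. v l) * real i + real (j - i) * (\<Sum>l = 1..i. v l)"
    using mult_left_mono[OF S, of "real (j - i)"] by (simp add: algebra_simps)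
  also have "\<dots> = (\<Sum>l = 1..i. v l) * real j"
    using assms(3) by (simp add: of_nat_diff algebra_simps)
  finally show ?thesis .
qed

lemma avg_antimono:
  assumes "\<forall>i j. 1 \<le> i \<and> i \<le> j \<and> j \<le> M \<longrightarrow> v j \<le> v i"
    and "1 \<le> i" and "i \<le> j" and "j \<le> M"
  shows "avg v j \<le> avg v i"
  using sum_mult_le_sum_mult[of M v i j] assms by (simp add: avg_def field_simps)

lemma avg_pos:
  assumes "\<forall>i j. 1 \<le> i \<and> i \<le> j \<and> j \<le> M \<longrightarrow> v j \<le> v i"
    and "v M > 0" and "1 \<le> j" and "j \<le> M"
  shows "avg v j > 0"
proof -
  have "v l > 0" if "l \<in> {1..j}" for l
    using assms(1)[rule_format, of l M] assms(2,4) that by auto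
  then have "(\<Sum>l = 1..j. v l) > 0"
    using assms(3) by (intro sum_pos) auto
  then show ?thesis
    using assms(3) by (simp add: avg_def)
qed

lemma path_strategy_layer_path:
  assumes "z 0 = 0"
  shows "path_strategy v (layer_path z k) = map (\<lambda>l. (avg v (z l), z l - z (l - 1))) [1..<Suc k]"
  unfolding path_strategy_def using path_pos_layer_path[of z, OF assms]
  by (auto simp del: upt_Suc)

text \<open>The quantities telescope; the truncated subtraction is exact because \<open>z\<close>
  increases up to \<open>k\<close>.\<close>

lemma cum_quantity_path_strategy:
  assumes "positions M k z" and "l \<le> k"
  shows "cum_quantity (map (\<lambda>l. (avg v (z l), z l - z (l - 1))) [1..<Suc k]) l = z l"
  using assms(2)
proof (induction l)
  case 0
  then show ?case
    using assms by (simp add: positions_def)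
next
  case (Suc l)
  let ?xs = "map (\<lambda>l. (avg v (z l), z l - z (l - 1))) [1..<Suc k]"
  have "snd (?xs ! l) = z (Suc l) - z l"
    using Suc.prems by (simp del: upt_Suc)
  moreover have "cum_quantity ?xs (Suc l) = cum_quantity ?xs l + snd (?xs ! l)"
    using Suc.prems by (intro cum_quantity_Suc) simp
  ultimately show ?case
    using positions_less[OF assms(1), of l] Suc by linarith
qed

lemma strategy_path_path_strategy:
  assumes "positions M k z"
  shows "strategy_path (path_strategy v (layer_path z k)) = layer_path z k"
proof -
  let ?xs = "map (\<lambda>l. (avg v (z l), z l - z (l - 1))) [1..<Suc k]"
  have "path_strategy v (layer_path z k) = ?xs"
    using assms by (intro path_strategy_layer_path) (simp add: positions_def)
  moreover have "layer_path (cum_quantity ?xs) k = layer_path z k"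
    using cum_quantity_path_strategy[OF assms] by (rule layer_path_cong)
  moreover have "length ?xs = k"
    by (simp del: upt_Suc)
  ultimately show ?thesis
    by (simp only: strategy_path_def)
qed

lemma avg_strategies_positions:
  assumes "xs \<in> avg_strategies R v M m"
  shows "positions M (length xs) (cum_quantity xs)" and "1 \<le> length xs" and "length xs \<le> m"
proof -
  show "1 \<le> length xs" "length xs \<le> m"
    using assms by (auto simp: avg_strategies_def uniform_strategy_def)
  have "snd (xs ! l) > 0" if "l < length xs" for l
    using assms nth_mem[OF that] by (auto simp: avg_strategies_def uniform_strategy_def)
  then show "positions M (length xs) (cum_quantity xs)"
    using assms
    by (auto simp: positions_def cum_quantity_Suc avg_strategies_def uniform_strategy_def)
qed

text \<open>The bids are determined by the cumulative quantities, so a path, which stores only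
  these, loses no information. This is independent of the order \<open>R\<close>.\<close>

lemma path_strategy_strategy_path:
  assumes "xs \<in> avg_strategies R v M m"
  shows "path_strategy v (strategy_path xs) = xs"
proof (rule nth_equalityI)
  show len: "length (path_strategy v (strategy_path xs)) = length xs"
    by (simp add: strategy_path_def path_strategy_def del: upt_Suc)
  fix i assume "i < length (path_strategy v (strategy_path xs))"
  then have i: "i < length xs"
    using len by simp
  then have "fst (xs ! i) = avg v (cum_quantity xs (Suc i))"
    using assms by (auto simp: avg_strategies_def uniform_strategy_def dest: bspec[of _ _ "Suc i"])
  then show "path_strategy v (strategy_path xs) ! i = xs ! i"
    using i by (simp add: strategy_path_def path_strategy_layer_path cum_quantity_Suc prod_eq_iff
        del: upt_Suc)
qed

lemma Pbar_subset_Pbar_weak: "Pbar v M m \<subseteq> Pbar_weak v M m"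
  unfolding Pbar_def Pbar_weak_def avg_strategies_def uniform_strategy_def
  by (auto intro: sorted_wrt_mono_rel[rotated])

lemma path_strategy_in_Pbar_weak:
  assumes dec: "\<forall>i j. 1 \<le> i \<and> i \<le> j \<and> j \<le> M \<longrightarrow> v j \<le> v i" and "v M > 0"
    and "1 \<le> k" and "k \<le> m" and z: "positions M k z"
  shows "path_strategy v (layer_path z k) \<in> Pbar_weak v M m"
proof -
  let ?xs = "map (\<lambda>l. (avg v (z l), z l - z (l - 1))) [1..<Suc k]"
  have range: "1 \<le> z l" "z l \<le> M" if "l \<in> {1..k}" for l
    using positions_ge[OF z, of l] positions_le[OF z, of l] that by auto
  have "sorted_wrt (\<ge>) (map fst ?xs)"
    unfolding sorted_wrt_iff_nth_less
    using range avg_antimono[OF dec] positions_mono[OF z] by (auto simp del: upt_Suc)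
  moreover have "b > 0 \<and> q > 0" if bq: "(b, q) \<in> set ?xs" for b q
  proof -
    obtain l where l: "l \<in> {1..k}" "b = avg v (z l)" "q = z l - z (l - 1)"
      using bq by (fastforce simp del: upt_Suc)
    then show ?thesis
      using avg_pos[OF dec assms(2)] range[of l] positions_less[OF z, of "l - 1"] by auto
  qed
  moreover have "fst (?xs ! (l - 1)) = avg v (cum_quantity ?xs l)" if "l \<in> {1..k}" for l
    using that cum_quantity_path_strategy[OF z, of l] by (auto simp del: upt_Suc)
  ultimately have "?xs \<in> Pbar_weak v M m"
    unfolding Pbar_weak_def avg_strategies_def uniform_strategy_def
    using assms(3,4) cum_quantity_path_strategy[OF z, of k] positions_le[OF z, of k]
    by (intro CollectI bexI[of _ k] conjI ballI) (auto simp del: upt_Suc set_upt set_map)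
  then show ?thesis
    using z by (simp add: path_strategy_layer_path positions_def del: upt_Suc)
qed

lemma bij_betw_path_strategy:
  assumes "\<forall>i j. 1 \<le> i \<and> i \<le> j \<and> j \<le> M \<longrightarrow> v j \<le> v i" and "v M > 0"
  shows "bij_betw (path_strategy v) (sd_paths M m) (Pbar_weak v M m)"
proof (rule bij_betwI[where g = strategy_path])
  show "path_strategy v \<in> sd_paths M m \<rightarrow> Pbar_weak v M m"
    using path_strategy_in_Pbar_weak[OF assms] by (auto simp: sd_paths_eq)
  show "strategy_path \<in> Pbar_weak v M m \<rightarrow> sd_paths M m"
    unfolding Pbar_weak_def strategy_path_def
    using avg_strategies_positions by (blast intro: layer_path_in_sd_paths)
  show "strategy_path (path_strategy v p) = p" if "p \<in> sd_paths M m" for p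
    using that strategy_path_path_strategy by (auto simp: sd_paths_eq)
  show "path_strategy v (strategy_path xs) = xs" if "xs \<in> Pbar_weak v M m" for xs
    using that path_strategy_strategy_path by (auto simp: Pbar_weak_def)
qed

section \<open>Merging blocks of equal bids\<close>

fun avg_bids :: "(nat \<Rightarrow> real) \<Rightarrow> nat \<Rightarrow> strategy \<Rightarrow> bool" where
  "avg_bids v c [] \<longleftrightarrow> True"
| "avg_bids v c ((b, q) # xs) \<longleftrightarrow> b = avg v (c + q) \<and> avg_bids v (c + q) xs"

text \<open>Links the indexed condition of \<open>avg_strategies\<close> to a recursive one with a
  running total \<open>c\<close>, which suits inductions along \<open>merge_bids\<close>.\<close>

lemma avg_bids_iff:
  "avg_bids v c xs \<longleftrightarrow> (\<forall>l < length xs. fst (xs ! l) = avg v (c + cum_quantity xs (Suc l)))"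
proof (induction xs arbitrary: c)
  case (Cons x xs)
  obtain b q where x: "x = (b, q)"
    by (cases x)
  show ?case
    unfolding x by (simp add: Cons.IH All_less_Suc2 cum_quantity_def add.assoc)
qed simp

lemma avg_strategies_iff:
  "xs \<in> avg_strategies R v M m \<longleftrightarrow> length xs \<in> {1..m} \<and> sorted_wrt R (map fst xs) \<and>
     (\<forall>x \<in> set xs. fst x > 0 \<and> snd x > 0) \<and> sum_list (map snd xs) \<le> M \<and> avg_bids v 0 xs"
proof -
  have "(\<forall>l \<in> {1..length xs}. P (l - 1) l) \<longleftrightarrow> (\<forall>l < length xs. P l (Suc l))" for P
    unfolding image_Suc_lessThan[symmetric] by auto
  from this[of "\<lambda>i l. fst (xs ! i) = avg v (cum_quantity xs l)"]
  show ?thesis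
    unfolding avg_strategies_def uniform_strategy_def avg_bids_iff
    by (auto simp: cum_quantity_def)
qed

fun merge_bids :: "strategy \<Rightarrow> strategy" where
  "merge_bids ((b, q) # (b', q') # xs) =
     (if b = b' then merge_bids ((b', q + q') # xs) else (b, q) # merge_bids ((b', q') # xs))"
| "merge_bids xs = xs"

lemma bid_vector_merge_bids: "bid_vector (merge_bids xs) = bid_vector xs"
  by (induction xs rule: merge_bids.induct) (auto simp: bid_vector_def replicate_add)

lemma length_merge_bids: "length (merge_bids xs) \<le> length xs" "merge_bids xs = [] \<longleftrightarrow> xs = []"
  by (induction xs rule: merge_bids.induct) auto

lemma sum_quantity_merge_bids: "sum_list (map snd (merge_bids xs)) = sum_list (map snd xs)"
  by (induction xs rule: merge_bids.induct) auto

lemma set_bids_merge_bids: "fst ` set (merge_bids xs) \<subseteq> fst ` set xs"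
  by (induction xs rule: merge_bids.induct) auto

lemma merge_bids_pos:
  "\<forall>x \<in> set xs. fst x > 0 \<and> snd x > 0 \<Longrightarrow> \<forall>x \<in> set (merge_bids xs). fst x > 0 \<and> snd x > 0"
  by (induction xs rule: merge_bids.induct) (auto split: if_splits)

text \<open>A merged block ends where its second part ended, so the common bid is still the average
  at the right end. Only the position between the two parts disappears.\<close>

lemma avg_bids_merge_bids: "avg_bids v c xs \<Longrightarrow> avg_bids v c (merge_bids xs)"
proof (induction xs arbitrary: c rule: merge_bids.induct)
  case (1 b q b' q' xs)
  then show ?case
    using 1(2)[of "c + q"] by (auto simp: add.assoc)
qed simp_all

lemma sorted_merge_bids:
  "sorted_wrt (\<ge>) (map fst xs) \<Longrightarrow> sorted_wrt (>) (map fst (merge_bids xs))"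
proof (induction xs rule: merge_bids.induct)
  case (1 b q b' q' xs)
  show ?case
  proof (cases "b = b'")
    case True
    then show ?thesis
      using 1 by simp
  next
    case False
    then have "\<forall>x \<in> fst ` set (merge_bids ((b', q') # xs)). x < b"
      using set_bids_merge_bids[of "(b', q') # xs"] 1(3) by fastforce
    then show ?thesis
      using 1(2,3) False by simp
  qed
qed simp_all

lemma merge_bids_in_Pbar: "xs \<in> Pbar_weak v M m \<Longrightarrow> merge_bids xs \<in> Pbar v M m"
  using length_merge_bids[of xs] merge_bids_pos[of xs] sorted_merge_bids[of xs]
    avg_bids_merge_bids[of v 0 xs]
  by (auto simp: Pbar_weak_def Pbar_def avg_strategies_iff sum_quantity_merge_bids Suc_le_eq)

lemma bid_vector_image_Pbar: "bid_vector ` Pbar v M m = bid_vector ` Pbar_weak v M m"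
proof
  show "bid_vector ` Pbar v M m \<subseteq> bid_vector ` Pbar_weak v M m"
    using Pbar_subset_Pbar_weak by (rule image_mono)
  show "bid_vector ` Pbar_weak v M m \<subseteq> bid_vector ` Pbar v M m"
    using merge_bids_in_Pbar bid_vector_merge_bids by (metis image_eqI image_subsetI)
qed

text \<open>With \<open>m = 1\<close> there is a single bid and nothing to order. Otherwise
  positions \<open>i < j\<close> with equal averages give a weak strategy of two blocks, ending at
  \<open>i\<close> and at \<open>j\<close>, whose bids tie; without such positions weakly decreasing
  averages are strictly decreasing.\<close>

lemma Pbar_eq_Pbar_weak_iff:
  assumes dec: "\<forall>i j. 1 \<le> i \<and> i \<le> j \<and> j \<le> M \<longrightarrow> v j \<le> v i" and pos: "v M > 0" and "1 \<le> m"
  shows "Pbar v M m = Pbar_weak v M m \<longleftrightarrow> m = 1 \<or> inj_on (avg v) {1..M}"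
proof
  assume eq: "Pbar v M m = Pbar_weak v M m"
  show "m = 1 \<or> inj_on (avg v) {1..M}"
  proof (rule ccontr)
    assume "\<not> (m = 1 \<or> inj_on (avg v) {1..M})"
    then have m: "2 \<le> m" and "\<not> inj_on (avg v) {1..M}"
      using assms(3) by auto
    then obtain i j where ij: "1 \<le> i" "i < j" "j \<le> M" "avg v i = avg v j"
      unfolding inj_on_def by (metis atLeastAtMost_iff linorder_neqE_nat)
    let ?xs = "[(avg v i, i), (avg v j, j - i)]"
    have "?xs \<in> Pbar_weak v M m"
      using ij m avg_pos[OF dec pos, of j] by (simp add: Pbar_weak_def avg_strategies_iff)
    moreover have "?xs \<notin> Pbar v M m"
      using ij by (simp add: Pbar_def avg_strategies_iff)
    ultimately show False
      using eq by simp
  qed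
next
  assume R: "m = 1 \<or> inj_on (avg v) {1..M}"
  have "xs \<in> Pbar v M m" if xs: "xs \<in> Pbar_weak v M m" for xs
  proof -
    have z: "positions M (length xs) (cum_quantity xs)" and k: "length xs \<le> m"
      using xs avg_strategies_positions by (auto simp: Pbar_weak_def)
    have bid: "fst (xs ! l) = avg v (cum_quantity xs (Suc l))" if "l < length xs" for l
      using xs that by (simp add: Pbar_weak_def avg_strategies_iff avg_bids_iff)
    have "fst (xs ! l') < fst (xs ! l)" if l: "l < l'" "l' < length xs" for l l'
    proof -
      have "inj_on (avg v) {1..M}"
        using R k l by auto
      moreover have "cum_quantity xs (Suc l) < cum_quantity xs (Suc l')"
        using positions_less[OF z, of l'] positions_mono[OF z, of "Suc l" l'] l by simp
      moreover have "1 \<le> cum_quantity xs (Suc l)" "cum_quantity xs (Suc l') \<le> M"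
        using positions_ge[OF z, of "Suc l"] positions_le[OF z, of "Suc l'"] l by auto
      ultimately have "avg v (cum_quantity xs (Suc l')) \<noteq> avg v (cum_quantity xs (Suc l))"
        "avg v (cum_quantity xs (Suc l')) \<le> avg v (cum_quantity xs (Suc l))"
        using avg_antimono[OF dec] by (auto dest!: inj_onD)
      then show ?thesis
        using bid l by simp
    qed
    then have "sorted_wrt (>) (map fst xs)"
      by (simp add: sorted_wrt_iff_nth_less)
    then show ?thesis
      using xs by (simp add: Pbar_def Pbar_weak_def avg_strategies_iff)
  qed
  then show "Pbar v M m = Pbar_weak v M m"
    using Pbar_subset_Pbar_weak by fast
qed

section \<open>The value of a bid vector\<close>

text \<open>The order that the stable sort of \<open>ranked_bids\<close> realizes: at equal bids the own ones come first.\<close>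

definition precedes :: "real \<times> bool \<Rightarrow> real \<times> bool \<Rightarrow> bool" where
  "precedes x y \<longleftrightarrow> fst y < fst x \<or> fst y = fst x \<and> (snd y \<longrightarrow> snd x)"

text \<open>Sorting inserts the list from its end: competing bids enter first, own bids afterwards,
  and \<open>insort_key\<close> puts a new element before those of equal key. The side condition on
  \<open>a\<close> expresses this order of insertion.\<close>

lemma sorted_precedes_insort:
  assumes "sorted_wrt precedes xs" and "snd a \<or> (\<forall>x \<in> set xs. \<not> snd x)"
  shows "sorted_wrt precedes (insort_key (\<lambda>x. - fst x) a xs)"
  using assms
proof (induction xs)
  case (Cons x xs)
  show ?case
  proof (cases "fst x \<le> fst a")
    case True
    have "precedes a y" if "y \<in> set xs" for y
    proof -
      have "precedes x y" and "snd a \<or> \<not> snd y"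
        using Cons.prems that by auto
      then show ?thesis
        using True by (auto simp: precedes_def)
    qed
    moreover have "precedes a x"
      using True Cons.prems(2) by (auto simp: precedes_def)
    ultimately show ?thesis
      using True Cons.prems(1) by simp
  next
    case False
    then have "precedes x a"
      by (simp add: precedes_def)
    then show ?thesis
      using False Cons by (auto simp: set_insort_key)
  qed
qed simp

lemma sorted_precedes_ranked_bids: "sorted_wrt precedes (ranked_bids b B)"
proof (induction b)
  case Nil
  show ?case
  proof (induction B)
    case (Cons a B)
    then show ?case
      by (simp add: ranked_bids_def sorted_precedes_insort)
  qed (simp add: ranked_bids_def)
next
  case (Cons a b)
  then show ?case
    by (simp add: ranked_bids_def sorted_precedes_insort)
qed

lemma filter_own_ranked_bids:
  assumes "sorted_wrt (\<ge>) b"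
  shows "filter snd (ranked_bids b B) = map (\<lambda>x. (x, True)) b"
proof -
  have "filter snd (ranked_bids b B) = sort_key (\<lambda>x. - fst x) (map (\<lambda>x. (x, True)) b)"
    by (simp add: ranked_bids_def filter_sort filter_map o_def)
  also have "\<dots> = map (\<lambda>x. (x, True)) b"
    using assms by (intro sort_key_id_if_sorted) (simp add: sorted_wrt_map)
  finally show ?thesis .
qed

lemma filter_competing_ranked_bids:
  "length (filter (\<lambda>x. \<not> snd x \<and> y < fst x) (ranked_bids b B)) = length (filter (\<lambda>x. y < x) B)"
  by (simp add: ranked_bids_def filter_sort filter_map o_def)

text \<open>The entries above \<open>y\<close> form a suffix of the ascending list, and the
  \<open>i\<close>-th entry is at most \<open>y\<close> iff this suffix starts after
  \<open>i\<close>.\<close>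

lemma sorted_nth_le_iff:
  fixes y :: "'a :: linorder"
  assumes "sorted s" and "i < length s"
  shows "s ! i \<le> y \<longleftrightarrow> length (filter (\<lambda>x. y < x) s) < length s - i"
proof
  assume le: "s ! i \<le> y"
  have "filter (\<lambda>x. y < x) (take (Suc i) s) = []"
    using order_trans[OF sorted_nth_mono[OF assms(1) _ assms(2)] le]
    by (auto simp: filter_empty_conv in_set_conv_nth not_less less_Suc_eq_le)
  then have "filter (\<lambda>x. y < x) s = filter (\<lambda>x. y < x) (drop (Suc i) s)"
    by (metis append_Nil append_take_drop_id filter_append)
  then show "length (filter (\<lambda>x. y < x) s) < length s - i"
    using assms(2) length_filter_le[of "\<lambda>x. y < x" "drop (Suc i) s"] by simp
next
  assume less: "length (filter (\<lambda>x. y < x) s) < length s - i"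
  show "s ! i \<le> y"
  proof (rule ccontr)
    assume "\<not> s ! i \<le> y"
    then have "\<forall>x \<in> set (drop i s). y < x"
      using less_le_trans[OF _ sorted_nth_mono[OF assms(1), of i]]
      by (auto simp: in_set_conv_nth not_le)
    then have "filter (\<lambda>x. y < x) (drop i s) = drop i s"
      by simp
    then have "length (filter (\<lambda>x. y < x) s) \<ge> length (drop i s)"
      by (metis append_take_drop_id filter_append le_add2 length_append)
    then show False
      using less by simp
  qed
qed

lemma kth_threshold_le_iff:
  assumes "K \<le> length B" and "1 \<le> k" and "k \<le> K"
  shows "kth_threshold K B k \<le> y \<longleftrightarrow> length (filter (\<lambda>x. y < x) B) \<le> K - k"
proof -
  \<comment> \<open>The top \<open>K\<close> bids are the last \<open>K\<close> entries of
    \<open>sort B\<close>; \<open>k - 1\<close> turns a 1-based rank into an index.\<close>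
  let ?i = "length B - K + (k - 1)"
  have "kth_threshold K B k = sort B ! ?i"
  proof -
    have "sort (take K (rev (sort B))) = drop (length B - K) (sort B)"
      by (rule properties_for_sort) (simp_all add: take_rev sorted_wrt_drop)
    then show ?thesis
      using assms by (simp add: kth_threshold_def)
  qed
  moreover have "length (filter (\<lambda>x. y < x) (sort B)) = length (filter (\<lambda>x. y < x) B)"
    by (simp add: filter_sort)
  ultimately show ?thesis
    using sorted_nth_le_iff[of "sort B" ?i y] assms by auto
qed

text \<open>Among the top \<open>K\<close> ranks exactly \<open>K - ?x\<close> bids are competing.
  If the \<open>k\<close>-th own bid wins, all larger competing bids are among these, and
  \<open>K - ?x\<close> is at most \<open>K - k\<close>. If it loses, all of these are strictly
  larger than it, and there are more than \<open>K - k\<close>.\<close>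

lemma units_won_ge_iff:
  assumes "sorted_wrt (\<ge>) b" and "K \<le> length B" and "1 \<le> k" and "k \<le> length b" and "k \<le> K"
  shows "k \<le> units_won K b B \<longleftrightarrow> kth_threshold K B k \<le> b ! (k - 1)"
proof -
  let ?r = "ranked_bids b B"
  let ?y = "b ! (k - 1)"
  let ?x = "units_won K b B"
  let ?P = "\<lambda>x. \<not> snd x \<and> ?y < fst x"
  define own where "own = filter snd (take K ?r)"
  define rest where "rest = filter snd (drop K ?r)"
  have len: "length (take K ?r) = K"
    using assms(2) by (simp add: ranked_bids_def)
  have own: "own @ rest = map (\<lambda>x. (x, True)) b" "length own = ?x"
    using filter_own_ranked_bids[OF assms(1), of B] filter_append[of snd "take K ?r" "drop K ?r"]
    by (simp_all add: own_def rest_def units_won_def)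
  have nth: "(own @ rest) ! (k - 1) = (?y, True)"
    using own assms by simp
  have sorted: "precedes x z" if "x \<in> set (take K ?r)" "z \<in> set (drop K ?r)" for x z
    using sorted_precedes_ranked_bids[of b B] that
    by (metis append_take_drop_id sorted_wrt_append)
  have others: "length (filter (\<lambda>x. \<not> snd x) (take K ?r)) = K - ?x"
    using sum_length_filter_compl[of snd "take K ?r"] len own(2) by (simp add: own_def)
  have "length (filter ?P ?r) = length (filter ?P (take K ?r)) + length (filter ?P (drop K ?r))"
    by (metis append_take_drop_id filter_append length_append)
  then have count: "length (filter (\<lambda>x. ?y < x) B)
      = length (filter ?P (take K ?r)) + length (filter ?P (drop K ?r))"
    by (simp only: filter_competing_ranked_bids)
  have "length (filter (\<lambda>x. ?y < x) B) \<le> K - k \<longleftrightarrow> k \<le> ?x"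
  proof
    assume k: "k \<le> ?x"
    then have "k - 1 < length own"
      using own(2) assms(3) by simp
    then have "(?y, True) \<in> set own"
      using nth nth_mem[of "k - 1" own] by (simp add: nth_append)
    then have "(?y, True) \<in> set (take K ?r)"
      by (simp add: own_def)
    then have "fst x \<le> ?y" if "x \<in> set (drop K ?r)" for x
      using sorted[of "(?y, True)" x] that by (auto simp: precedes_def)
    then have "filter ?P (drop K ?r) = []"
      by (simp add: filter_empty_conv not_less)
    moreover have "length (filter ?P (take K ?r)) \<le> length (filter (\<lambda>x. \<not> snd x) (take K ?r))"
      using length_filter_le[of "\<lambda>x. ?y < fst x" "filter (\<lambda>x. \<not> snd x) (take K ?r)"]
      by (simp add: conj_commute)
    ultimately show "length (filter (\<lambda>x. ?y < x) B) \<le> K - k"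
      using count others k by simp
  next
    assume le: "length (filter (\<lambda>x. ?y < x) B) \<le> K - k"
    show "k \<le> ?x"
    proof (rule ccontr)
      assume k: "\<not> k \<le> ?x"
      have "length own + length rest = length b"
        using own(1) by (metis length_append length_map)
      then have "k - 1 - length own < length rest" "\<not> k - 1 < length own"
        using k own(2) assms(3,4) by linarith+
      then have "(?y, True) \<in> set rest"
        using nth nth_mem[of "k - 1 - length own" rest] by (simp add: nth_append)
      then have "(?y, True) \<in> set (drop K ?r)"
        by (simp add: rest_def)
      \<comment> \<open>A competing bid ranked before a losing own bid cannot tie with it, since
        ties favour the bidder.\<close>
      then have "?P x \<longleftrightarrow> \<not> snd x" if "x \<in> set (take K ?r)" for x
        using sorted[of x "(?y, True)"] that by (auto simp: precedes_def)
      then have "filter ?P (take K ?r) = filter (\<lambda>x. \<not> snd x) (take K ?r)"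
        by (rule filter_cong[OF refl])
      then show False
        using count others le k assms(5) by simp
    qed
  qed
  then show ?thesis
    using kth_threshold_le_iff[OF assms(2,3,5)] by simp
qed

lemma units_won_le:
  assumes "sorted_wrt (\<ge>) b"
  shows "units_won K b B \<le> length b"
proof -
  have "units_won K b B \<le> length (filter snd (ranked_bids b B))"
    unfolding units_won_def
    by (metis append_take_drop_id filter_append le_add1 length_append)
  then show ?thesis
    by (simp add: filter_own_ranked_bids[OF assms])
qed

text \<open>The indices satisfying the threshold condition form an initial segment, namely
  \<open>1..units_won K b B\<close>, so the indicators cut the sum off at the number of units
  won.\<close>

lemma round_value_eq:
  assumes "sorted_wrt (\<ge>) b" and "K \<le> length B" and "length b \<le> K"
  shows "round_value K v b B =
    (\<Sum>k = 1..length b. v k * of_bool (kth_threshold K B k \<le> b ! (k - 1)))"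
proof -
  have "(\<Sum>k = 1..length b. v k * of_bool (kth_threshold K B k \<le> b ! (k - 1)))
      = (\<Sum>k = 1..length b. if k \<in> {1..units_won K b B} then v k else 0)"
    using units_won_ge_iff[OF assms(1,2)] assms(3) by (intro sum.cong) auto
  also have "\<dots> = (\<Sum>k \<in> {1..length b} \<inter> {1..units_won K b B}. v k)"
    by (subst sum.inter_restrict) auto
  also have "{1..length b} \<inter> {1..units_won K b B} = {1..units_won K b B}"
    using units_won_le[OF assms(1), of K B] by auto
  finally show ?thesis
    by (simp add: round_value_def)
qed

section \<open>Bid vectors as sequences of blocks\<close>

lemma length_bid_vector: "length (bid_vector xs) = sum_list (map snd xs)"
  by (induction xs) (auto simp: bid_vector_def)

lemma sorted_bid_vector:
  "sorted_wrt (\<ge>) (map fst xs) \<Longrightarrow> sorted_wrt (\<ge>) (bid_vector xs)"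
proof (induction xs)
  case (Cons x xs)
  obtain b q where x: "x = (b, q)"
    by (cases x)
  have "sorted_wrt (\<ge>) (replicate q b)"
    by (induction q) auto
  moreover have "\<forall>y \<in> set (bid_vector xs). y \<le> b"
    using Cons.prems by (auto simp: x bid_vector_def)
  ultimately show ?case
    using Cons by (auto simp: x bid_vector_def sorted_wrt_append)
qed (simp add: bid_vector_def)

text \<open>Induction from the right, because appending a block leaves the earlier cumulative
  quantities and bids in place.\<close>

lemma sum_bid_vector:
  fixes f :: "nat \<Rightarrow> real \<Rightarrow> real"
  shows "(\<Sum>k = 1..length (bid_vector xs). f k (bid_vector xs ! (k - 1))) =
    (\<Sum>l < length xs. \<Sum>k = cum_quantity xs l + 1..cum_quantity xs (Suc l). f k (fst (xs ! l)))"
proof (induction xs rule: rev_induct)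
  case Nil
  then show ?case
    by (simp add: bid_vector_def)
next
  case (snoc x xs)
  obtain b q where x: "x = (b, q)"
    by (cases x)
  let ?n = "length (bid_vector xs)"
  have bv: "bid_vector (xs @ [x]) = bid_vector xs @ replicate q b"
    by (simp add: x bid_vector_def)
  have cum: "cum_quantity (xs @ [x]) l = cum_quantity xs l" if "l \<le> length xs" for l
    using that by (simp add: cum_quantity_def)
  have n: "cum_quantity xs (length xs) = ?n" "cum_quantity (xs @ [x]) (Suc (length xs)) = ?n + q"
    by (simp_all add: cum_quantity_def length_bid_vector x)
  have "(\<Sum>k = 1..length (bid_vector (xs @ [x])). f k (bid_vector (xs @ [x]) ! (k - 1)))
     = (\<Sum>k = 1..?n. f k (bid_vector (xs @ [x]) ! (k - 1)))
       + (\<Sum>k = ?n + 1..?n + q. f k (bid_vector (xs @ [x]) ! (k - 1)))"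
    using sum.ub_add_nat[of 1 ?n "\<lambda>k. f k (bid_vector (xs @ [x]) ! (k - 1))" q] by (simp add: bv)
  also have "(\<Sum>k = 1..?n. f k (bid_vector (xs @ [x]) ! (k - 1)))
      = (\<Sum>k = 1..?n. f k (bid_vector xs ! (k - 1)))"
    by (intro sum.cong) (auto simp: bv nth_append)
  also have "(\<Sum>k = ?n + 1..?n + q. f k (bid_vector (xs @ [x]) ! (k - 1)))
      = (\<Sum>k = ?n + 1..?n + q. f k b)"
    by (intro sum.cong) (auto simp: bv nth_append)
  finally show ?case
    using cum n snoc by (simp add: x nth_append)
qed

section \<open>Values and path weights\<close>

lemma path_weight_layer_path:
  "path_weight w (layer_path z k) =
    (\<Sum>l<k. w (Layer l (z l), Layer (Suc l) (z (Suc l)))) + w (Layer k (z k), Dest)"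
proof -
  have "sum_list (map w (map (\<lambda>l. (Layer (l - 1) (z (l - 1)), Layer l (z l))) [1..<k + 1]))
      = (\<Sum>l<k. w (Layer l (z l), Layer (Suc l) (z (Suc l))))"
    by (induction k) simp_all
  then show ?thesis
    by (simp add: path_weight_eq layer_path_def)
qed

lemma total_value_eq_path_weight:
  assumes xs: "xs \<in> Pbar_weak v M m" and "M \<le> K" and B: "\<forall>t \<in> {1..T}. K \<le> length (B t)"
  shows "total_value K T v B xs = path_weight (edge_weight K T v B) (strategy_path xs)"
proof -
  let ?z = "cum_quantity xs"
  define f where "f t k x = v k * of_bool (kth_threshold K (B t) k \<le> x)" for t k x
  have len: "length (bid_vector xs) \<le> K" and sorted: "sorted_wrt (\<ge>) (bid_vector xs)"
    and bids: "\<forall>l < length xs. fst (xs ! l) = avg v (?z (Suc l))"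
    using xs assms(2) sorted_bid_vector
    by (auto simp: Pbar_weak_def avg_strategies_iff avg_bids_iff length_bid_vector)
  have "total_value K T v B xs =
      (\<Sum>t = 1..T. \<Sum>k = 1..length (bid_vector xs). f t k (bid_vector xs ! (k - 1)))"
    unfolding total_value_def f_def using round_value_eq[OF sorted _ len] B
    by (intro sum.cong) auto
  also have "\<dots> = (\<Sum>t = 1..T. \<Sum>l < length xs. \<Sum>k = ?z l + 1..?z (Suc l). f t k (fst (xs ! l)))"
    by (simp only: sum_bid_vector)
  also have "\<dots> = (\<Sum>l < length xs. \<Sum>t = 1..T. \<Sum>k = ?z l + 1..?z (Suc l). f t k (fst (xs ! l)))"
    by (rule sum.swap)
  also have "\<dots> = (\<Sum>l < length xs. edge_weight K T v B (Layer l (?z l), Layer (Suc l) (?z (Suc l))))"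
    using bids by (intro sum.cong) (auto simp: f_def)
  finally show ?thesis
    by (simp add: strategy_path_def path_weight_layer_path)
qed

lemma total_value_merge_bids: "total_value K T v B (merge_bids xs) = total_value K T v B xs"
  by (simp add: total_value_def bid_vector_merge_bids)

text \<open>Equality of the sets of values suffices for maxima and maximizers, and it holds for
  \<open>Pbar\<close> even if there are more paths than strict strategies.\<close>

lemma total_value_image:
  assumes "\<forall>i j. 1 \<le> i \<and> i \<le> j \<and> j \<le> M \<longrightarrow> v j \<le> v i" and "v M > 0"
    and "M \<le> K" and "\<forall>t \<in> {1..T}. K \<le> length (B t)"
    and P: "P \<in> {Pbar v M m, Pbar_weak v M m}"
  shows "total_value K T v B ` P = path_weight (edge_weight K T v B) ` sd_paths M m"
proof -
  let ?f = "total_value K T v B" and ?g = "path_weight (edge_weight K T v B)"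
  have bij: "path_strategy v ` sd_paths M m = Pbar_weak v M m"
    using bij_betw_path_strategy[OF assms(1,2)] by (rule bij_betw_imp_surj_on)
  have "?f (path_strategy v p) = ?g p" if "p \<in> sd_paths M m" for p
  proof -
    have "path_strategy v p \<in> Pbar_weak v M m"
      using bij that by blast
    then show ?thesis
      using total_value_eq_path_weight assms(3,4) strategy_path_path_strategy that
      by (fastforce simp: sd_paths_eq)
  qed
  then have weak: "?f ` Pbar_weak v M m = ?g ` sd_paths M m"
    unfolding bij[symmetric] image_image by (rule image_cong[OF refl])
  have "?f xs \<in> ?f ` Pbar v M m" if "xs \<in> Pbar_weak v M m" for xs
    using merge_bids_in_Pbar[OF that] total_value_merge_bids by (metis imageI)
  then have "?f ` Pbar v M m = ?f ` Pbar_weak v M m"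
    using Pbar_subset_Pbar_weak by (intro equalityI image_mono image_subsetI)
  then show ?thesis
    using weak P by auto
qed

lemma is_arg_max_cong_image:
  fixes f :: "'a \<Rightarrow> 'c :: linorder" and g :: "'b \<Rightarrow> 'c"
  assumes "f ` A = g ` C" and "a \<in> A" and "c \<in> C" and "f a = g c"
  shows "is_arg_max f (\<lambda>x. x \<in> A) a \<longleftrightarrow> is_arg_max g (\<lambda>x. x \<in> C) c"
proof -
  have "(\<forall>y \<in> f ` A. y \<le> f a) \<longleftrightarrow> (\<forall>y \<in> g ` C. y \<le> g c)"
    using assms by simp
  then show ?thesis
    using assms(2,3) by (auto simp: is_arg_max_linorder)
qed

lemma values_and_paths:
  assumes "1 \<le> M" and "M \<le> K" and "1 \<le> m"
    and dec: "\<forall>i j. 1 \<le> i \<and> i \<le> j \<and> j \<le> M \<longrightarrow> v j \<le> v i" and pos: "v M > 0"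
    and B: "\<forall>t \<in> {1..T}. K \<le> length (B t)"
    and P: "P \<in> {Pbar v M m, Pbar_weak v M m}"
  shows "\<forall>b \<in> P. total_value K T v B b = path_weight (edge_weight K T v B) (strategy_path b)"
    and "finite P" and "P \<noteq> {}"
    and "Max (total_value K T v B ` P) = Max (path_weight (edge_weight K T v B) ` sd_paths M m)"
    and "\<forall>b \<in> P. is_arg_max (total_value K T v B) (\<lambda>b. b \<in> P) b \<longleftrightarrow>
           is_arg_max (path_weight (edge_weight K T v B)) (\<lambda>p. p \<in> sd_paths M m) (strategy_path b)"
proof -
  have sub: "P \<subseteq> Pbar_weak v M m"
    using P Pbar_subset_Pbar_weak by auto
  note im = total_value_image[OF dec pos assms(2) B P]
  show val: "\<forall>b \<in> P. total_value K T v B b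
      = path_weight (edge_weight K T v B) (strategy_path b)"
    using sub total_value_eq_path_weight assms(2) B by blast
  have "finite (Pbar_weak v M m)"
    using bij_betw_finite[OF bij_betw_path_strategy[OF dec pos]] finite_sd_paths by blast
  then show "finite P"
    by (rule finite_subset[OF sub])
  show "P \<noteq> {}"
    using im sd_paths_nonempty[OF assms(1,3)] by auto
  show "Max (total_value K T v B ` P) = Max (path_weight (edge_weight K T v B) ` sd_paths M m)"
    by (simp only: im)
  show "\<forall>b \<in> P. is_arg_max (total_value K T v B) (\<lambda>b. b \<in> P) b \<longleftrightarrow>
     is_arg_max (path_weight (edge_weight K T v B)) (\<lambda>p. p \<in> sd_paths M m) (strategy_path b)"
  proof
    fix b assume b: "b \<in> P"
    then have "strategy_path b \<in> sd_paths M m"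
      using sub avg_strategies_positions[of b]
      by (auto simp: Pbar_weak_def strategy_path_def intro!: layer_path_in_sd_paths)
    then show "is_arg_max (total_value K T v B) (\<lambda>b. b \<in> P) b \<longleftrightarrow>
       is_arg_max (path_weight (edge_weight K T v B)) (\<lambda>p. p \<in> sd_paths M m) (strategy_path b)"
      using im b val by (intro is_arg_max_cong_image) auto
  qed
qed

section \<open>Computing a maximum weight path\<close>

text \<open>A total correctness triple with a time budget. The budget is an upper bound, so branches
  and iterations of different cost can share one; postconditions can be \<open>runs\<close>
  statements again, which handles sequencing.\<close>

definition runs :: "(edge \<Rightarrow> real) \<Rightarrow> com \<Rightarrow> state \<Rightarrow> nat \<Rightarrow> (state \<Rightarrow> bool) \<Rightarrow> bool" where
  "runs w c s n Q \<longleftrightarrow> (\<exists>n' s'. exec w c s n' s' \<and> n' \<le> n \<and> Q s')"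

lemma runs_Skip: "Q s \<Longrightarrow> runs w Skip s 1 Q"
  unfolding runs_def by (blast intro: exec.Skip)

lemma runs_NAssign:
  "Q (upd (fst s) x (nval (fst s) i) (nval (fst s) e), snd s) \<Longrightarrow> runs w (NAssign x i e) s 1 Q"
  unfolding runs_def by (cases s) (auto intro!: exI exec.NAssign)

lemma runs_RAssign:
  "Q (fst s, upd (snd s) x (nval (fst s) i) (rval w s e)) \<Longrightarrow> runs w (RAssign x i e) s 1 Q"
  unfolding runs_def by (cases s) (auto intro!: exI exec.RAssign)

lemma runs_mono: "runs w c s n Q \<Longrightarrow> n \<le> n' \<Longrightarrow> (\<And>s'. Q s' \<Longrightarrow> Q' s') \<Longrightarrow> runs w c s n' Q'"
  unfolding runs_def by (meson order_trans)

text \<open>The first command is charged to the right summand. Budgets written as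
  \<open>1 + 1 + ...\<close> nest to the left, so reading one from right to left follows the
  program, and \<open>intro\<close> splits it correctly.\<close>

lemma runs_Seq: "runs w c s n (\<lambda>s'. runs w d s' n' Q) \<Longrightarrow> runs w (Seq c d) s (n' + n) Q"
  unfolding runs_def by (metis add.commute add_mono exec.Seq)

lemma runs_Cond:
  assumes "holds w s b \<Longrightarrow> runs w c s n Q" and "\<not> holds w s b \<Longrightarrow> runs w d s n Q"
  shows "runs w (Cond b c d) s (n + 1) Q"
  using assms unfolding runs_def by (meson add_le_mono1 exec.CondFalse exec.CondTrue)

lemma runs_While_False: "\<not> holds w s b \<Longrightarrow> Q s \<Longrightarrow> runs w (While b c) s (n + 1) Q"
  unfolding runs_def by (meson exec.WhileFalse le_add2)

text \<open>\<open>f\<close> is a variant: at most \<open>k\<close> iterations of cost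
  \<open>n + 1\<close> including the test, then one failing test. At variant 0 the test must fail,
  as no iteration could decrease it.\<close>

lemma runs_While:
  fixes f :: "state \<Rightarrow> nat"
  assumes "I s" and "f s \<le> k"
    and step: "\<And>s. I s \<Longrightarrow> holds w s b \<Longrightarrow> runs w c s n (\<lambda>s'. I s' \<and> f s' < f s)"
    and exit: "\<And>s. I s \<Longrightarrow> \<not> holds w s b \<Longrightarrow> Q s"
  shows "runs w (While b c) s ((n + 1) * k + 1) Q"
  using assms(1,2)
proof (induction k arbitrary: s)
  case 0
  then have "\<not> holds w s b"
    using step[of s] by (auto simp: runs_def)
  then show ?case
    using exit 0(1) by (intro runs_While_False)
next
  case (Suc k)
  show ?case
  proof (cases "holds w s b")
    case True
    from step[OF Suc.prems(1) this] obtain n1 s1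
      where s1: "exec w c s n1 s1" "n1 \<le> n" "I s1" "f s1 < f s"
      by (auto simp: runs_def)
    with Suc.IH[of s1] Suc.prems(2) obtain n2 s2
      where s2: "exec w (While b c) s1 n2 s2" "n2 \<le> (n + 1) * k + 1" "Q s2"
      by (auto simp: runs_def)
    have "exec w (While b c) s (n1 + n2 + 1) s2"
      using True s1(1) s2(1) by (rule exec.WhileTrue)
    moreover have "n1 + n2 + 1 \<le> (n + 1) * Suc k + 1"
      using s1(2) s2(2) by simp
    ultimately show ?thesis
      unfolding runs_def using s2(3) by blast
  next
    case False
    then show ?thesis
      using exit Suc.prems(1) by (intro runs_While_False)
  qed
qed

section \<open>Scanning the successors of a node\<close>

abbreviation nvar :: "string \<Rightarrow> nexp" where
  "nvar x \<equiv> NArr x (Num 0)"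

definition candidate :: rexp where
  "candidate = RAdd (Weight (nvar ''l'') (nvar ''j'') (nvar ''i'')) (RArr ''F'' (nvar ''i''))"

definition slot :: nexp where
  "slot = NAdd (nvar ''o'') (nvar ''j'')"

text \<open>The start index, the running maximum and the recorded successor are initialised by the
  caller, so the same loop serves the source and the other nodes.\<close>

definition scan :: com where
  "scan = While (NLess (nvar ''i'') (NAdd (nvar ''M'') (Num 1)))
     (Seq (Cond (RLess (RArr ''b'' (Num 0)) candidate)
        (Seq (RAssign ''b'' (Num 0) candidate) (NAssign ''next'' slot (nvar ''i'')))
        Skip)
     (NAssign ''i'' (Num 0) (NAdd (nvar ''i'') (Num 1))))"

lemma upd_same: "upd f x i (f x i) = f"
  by (simp add: upd_def)

lemma upd_apply: "upd f x i a y = (if y = x then (f x)(i := a) else f y)"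
  by (simp add: upd_def)

lemma runs_scan:
  fixes w :: "edge \<Rightarrow> real" and N :: nstore and R :: rstore
  defines "g \<equiv> \<lambda>i. w (Layer (N ''l'' 0) (N ''j'' 0), Layer (Suc (N ''l'' 0)) i) + R ''F'' i"
    and "p \<equiv> N ''o'' 0 + N ''j'' 0" and "a \<equiv> N ''i'' 0" and "M \<equiv> N ''M'' 0"
  assumes a: "a \<le> Suc M"
    and post: "\<And>i x y. R ''b'' 0 \<le> y \<Longrightarrow> (\<And>i. a \<le> i \<Longrightarrow> i \<le> M \<Longrightarrow> g i \<le> y) \<Longrightarrow>
      x = N ''next'' p \<and> y = R ''b'' 0 \<or> a \<le> x \<and> x \<le> M \<and> y = g x \<Longrightarrow>
      Q (upd (upd N ''i'' 0 i) ''next'' p x, upd R ''b'' 0 y)"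
  shows "runs w scan (N, R) (5 * Suc M + 1) Q"
proof -
  \<comment> \<open>The loop changes three cells only, so its states form a family with three
    parameters, and the invariant speaks of these.\<close>
  define st where "st i x y = (upd (upd N ''i'' 0 i) ''next'' p x, upd R ''b'' 0 y)" for i x y
  define I where "I s \<longleftrightarrow> (\<exists>i x y. s = st i x y \<and> a \<le> i \<and> i \<le> Suc M \<and> R ''b'' 0 \<le> y \<and>
     (\<forall>i' \<in> {a..<i}. g i' \<le> y) \<and>
     (x = N ''next'' p \<and> y = R ''b'' 0 \<or> a \<le> x \<and> x < i \<and> y = g x))" for s
  have cand: "rval w (st i x y) candidate = g i" for i x y
    by (simp add: candidate_def st_def g_def upd_apply)
  have slot: "nval (fst (st i x y)) slot = p" for i x y
    by (simp add: slot_def st_def p_def upd_apply)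
  \<comment> \<open>An iteration costs 3 for the conditional, 1 for the increment and 1 for the loop
    test.\<close>
  have "runs w scan (N, R) ((1 + (1 + 1 + 1) + 1) * Suc M + 1) Q"
    unfolding scan_def
  proof (rule runs_While[where I = I and f = "\<lambda>s. Suc M - fst s ''i'' 0"])
    have "(N, R) = st a (N ''next'' p) (R ''b'' 0)"
      by (simp add: st_def a_def upd_same)
    then show "I (N, R)"
      unfolding I_def using a by (intro exI[of _ a] exI[of _ "N ''next'' p"] exI[of _ "R ''b'' 0"]) simp
  next
    fix s assume "I s" and test: "holds w s (NLess (nvar ''i'') (NAdd (nvar ''M'') (Num 1)))"
    then obtain i x y where s: "s = st i x y" "a \<le> i" "R ''b'' 0 \<le> y" "\<forall>i' \<in> {a..<i}. g i' \<le> y"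
      "x = N ''next'' p \<and> y = R ''b'' 0 \<or> a \<le> x \<and> x < i \<and> y = g x"
      unfolding I_def by blast
    have i: "i \<le> M"
      using test by (simp add: s(1) st_def upd_apply M_def)
    let ?J = "\<lambda>s'. I s' \<and> Suc M - fst s' ''i'' 0 < Suc M - fst s ''i'' 0"
    have next_step: "runs w (NAssign ''i'' (Num 0) (NAdd (nvar ''i'') (Num 1))) (st i x' y') 1 ?J"
      if "R ''b'' 0 \<le> y'" "\<forall>i' \<in> {a..<Suc i}. g i' \<le> y'"
        "x' = N ''next'' p \<and> y' = R ''b'' 0 \<or> a \<le> x' \<and> x' < Suc i \<and> y' = g x'" for x' y'
    proof -
      have "upd (upd (upd N ''i'' 0 i) ''next'' p x') ''i'' 0 (Suc i)
          = upd (upd N ''i'' 0 (Suc i)) ''next'' p x'"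
        by (simp add: upd_def fun_upd_twist)
      then have "(upd (fst (st i x' y')) ''i'' 0 (Suc i), snd (st i x' y')) = st (Suc i) x' y'"
        by (simp add: st_def)
      moreover have "I (st (Suc i) x' y')"
        unfolding I_def using that s(2) i by (intro exI[of _ "Suc i"] exI[of _ x'] exI[of _ y']) simp
      moreover have "fst (st k x'' y'') ''i'' 0 = k" for k x'' y''
        by (simp add: st_def upd_apply)
      ultimately show ?thesis
        using i unfolding s(1) by (intro runs_NAssign) simp
    qed
    show "runs w (Seq (Cond (RLess (RArr ''b'' (Num 0)) candidate)
        (Seq (RAssign ''b'' (Num 0) candidate) (NAssign ''next'' slot (nvar ''i''))) Skip)
      (NAssign ''i'' (Num 0) (NAdd (nvar ''i'') (Num 1)))) s (1 + (1 + 1 + 1)) ?J"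
    proof (intro runs_Seq runs_Cond)
      have y: "rval w s (RArr ''b'' (Num 0)) = y"
        by (simp add: s(1) st_def upd_apply)
      {
        assume "holds w s (RLess (RArr ''b'' (Num 0)) candidate)"
        then have less: "y < g i"
          using y by (simp add: s(1) cand)
        then have "\<forall>i' \<in> {a..<Suc i}. g i' \<le> g i"
          using s(4) by (force simp: less_Suc_eq)
        then have step: "runs w (NAssign ''i'' (Num 0) (NAdd (nvar ''i'') (Num 1))) (st i i (g i)) 1 ?J"
          using s(2,3) less by (intro next_step) auto
        have new: "st i i (g i) = (upd (fst (st i x y)) ''next'' p i, upd (snd (st i x y)) ''b'' 0 (g i))"
          by (simp add: st_def upd_def)
        have i_val: "nval (fst (st i x y)) (nvar ''i'') = i"
          by (simp add: st_def upd_apply)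
        show "runs w (RAssign ''b'' (Num 0) candidate) s 1
          (\<lambda>s'. runs w (NAssign ''next'' slot (nvar ''i'')) s' 1
             (\<lambda>s'. runs w (NAssign ''i'' (Num 0) (NAdd (nvar ''i'') (Num 1))) s' 1 ?J))"
          unfolding s(1)
          by (rule runs_RAssign, rule runs_NAssign)
            (use step in \<open>simp only: fst_conv snd_conv cand slot i_val nval.simps(1) new s(1)\<close>)
      next
        assume "\<not> holds w s (RLess (RArr ''b'' (Num 0)) candidate)"
        then have "g i \<le> y"
          using y by (simp add: s(1) cand)
        then have "runs w (NAssign ''i'' (Num 0) (NAdd (nvar ''i'') (Num 1))) (st i x y) 1 ?J"
          using s(2-5) by (intro next_step) (auto simp: less_Suc_eq)
        then have "runs w (NAssign ''i'' (Num 0) (NAdd (nvar ''i'') (Num 1))) s 1 ?J"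
          by (simp only: s(1))
        from runs_mono[OF runs_Skip[of "\<lambda>s'. runs w (NAssign ''i'' (Num 0) (NAdd (nvar ''i'') (Num 1))) s' 1 ?J", OF this]]
        show "runs w Skip s (1 + 1)
          (\<lambda>s'. runs w (NAssign ''i'' (Num 0) (NAdd (nvar ''i'') (Num 1))) s' 1 ?J)"
          by simp
      }
    qed
  next
    fix s assume "I s" and "\<not> holds w s (NLess (nvar ''i'') (NAdd (nvar ''M'') (Num 1)))"
    then show "Q s"
      unfolding I_def by (auto simp: st_def upd_apply M_def[symmetric] less_Suc_eq_le intro!: post)
  qed simp
  then show ?thesis
    by (rule runs_mono) simp_all
qed

section \<open>One layer of the dynamic program\<close>

text \<open>\<open>y\<close> is the maximum over stopping at node \<open>(l, j)\<close> and moving on to a node \<open>(l + 1, i)\<close> of value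
  \<open>F i\<close>; \<open>x\<close> is a maximizer, \<open>0\<close> standing for a stop.\<close>

definition best_step ::
    "(edge \<Rightarrow> real) \<Rightarrow> nat \<Rightarrow> nat \<Rightarrow> (nat \<Rightarrow> real) \<Rightarrow> nat \<Rightarrow> real \<Rightarrow> nat \<Rightarrow> bool" where
  "best_step w M l F j y x \<longleftrightarrow> 0 \<le> y \<and> (\<forall>i. j < i \<and> i \<le> M \<longrightarrow> w (Layer l j, Layer (Suc l) i) + F i \<le> y) \<and>
     (x = 0 \<and> y = 0 \<or> j < x \<and> x \<le> M \<and> y = w (Layer l j, Layer (Suc l) x) + F x)"

lemma best_step_cong:
  assumes "\<And>i. j < i \<Longrightarrow> i \<le> M \<Longrightarrow> F i = F' i"
  shows "best_step w M l F j = best_step w M l F' j"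
  using assms by (auto simp: best_step_def fun_eq_iff)

text \<open>The array \<open>F\<close> is overwritten in place: the new value at \<open>j\<close> depends only on old values at
  \<open>i > j\<close>, so \<open>j\<close> runs upwards.\<close>

definition row_body :: com where
  "row_body = Seq (RAssign ''b'' (Num 0) Zero) (Seq (NAssign ''next'' slot (Num 0))
     (Seq (NAssign ''i'' (Num 0) (NAdd (nvar ''j'') (Num 1))) (Seq scan
     (Seq (RAssign ''F'' (nvar ''j'') (RArr ''b'' (Num 0)))
       (NAssign ''j'' (Num 0) (NAdd (nvar ''j'') (Num 1)))))))"

definition row :: com where
  "row = Seq (NAssign ''j'' (Num 0) (Num 0))
     (While (NLess (nvar ''j'') (NAdd (nvar ''M'') (Num 1))) row_body)"

lemma runs_row_body:
  fixes N :: nstore and R :: rstore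
  defines "j \<equiv> N ''j'' 0" and "p \<equiv> N ''o'' 0 + N ''j'' 0"
  assumes j: "j \<le> N ''M'' 0"
    and post: "\<And>N' R' x y. best_step w (N ''M'' 0) (N ''l'' 0) (R ''F'') j y x \<Longrightarrow>
      N' ''j'' 0 = Suc j \<Longrightarrow> N' ''next'' = (N ''next'')(p := x) \<Longrightarrow> R' ''F'' = (R ''F'')(j := y) \<Longrightarrow>
      (\<And>u. u \<notin> {''i'', ''j'', ''next''} \<Longrightarrow> N' u = N u) \<Longrightarrow> Q (N', R')"
  shows "runs w row_body (N, R) (1 + 1 + (5 * Suc (N ''M'' 0) + 1) + 1 + 1 + 1) Q"
proof -
  let ?N = "upd (upd N ''next'' p 0) ''i'' 0 (Suc j)" and ?R = "upd R ''b'' 0 0"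
  have "runs w scan (?N, ?R) (5 * Suc (N ''M'' 0) + 1)
    (\<lambda>s'. runs w (Seq (RAssign ''F'' (nvar ''j'') (RArr ''b'' (Num 0)))
       (NAssign ''j'' (Num 0) (NAdd (nvar ''j'') (Num 1)))) s' (1 + 1) Q)"
  proof (rule runs_mono[OF runs_scan])
    fix i x y
    let ?N' = "upd (upd ?N ''i'' 0 i) ''next'' (?N ''o'' 0 + ?N ''j'' 0) x" and ?R' = "upd ?R ''b'' 0 y"
    let ?g = "\<lambda>i. w (Layer (?N ''l'' 0) (?N ''j'' 0), Layer (Suc (?N ''l'' 0)) i) + ?R ''F'' i"
    assume "?R ''b'' 0 \<le> y"
      and "\<And>i. ?N ''i'' 0 \<le> i \<Longrightarrow> i \<le> ?N ''M'' 0 \<Longrightarrow> ?g i \<le> y"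
      and "x = ?N ''next'' (?N ''o'' 0 + ?N ''j'' 0) \<and> y = ?R ''b'' 0 \<or>
        ?N ''i'' 0 \<le> x \<and> x \<le> ?N ''M'' 0 \<and> y = ?g x"
    then have "best_step w (N ''M'' 0) (N ''l'' 0) (R ''F'') j y x"
      by (simp add: best_step_def upd_apply j_def p_def Suc_le_eq)
    then show "runs w (Seq (RAssign ''F'' (nvar ''j'') (RArr ''b'' (Num 0)))
       (NAssign ''j'' (Num 0) (NAdd (nvar ''j'') (Num 1)))) (?N', ?R') (1 + 1) Q"
      by (intro runs_Seq runs_RAssign runs_NAssign post[of y x]) (simp_all add: upd_apply j_def p_def)
  qed (use j in \<open>simp_all add: upd_apply\<close>)
  then show ?thesis
    unfolding row_body_def
    by (intro runs_Seq[where n' = "_ + 1 + 1"] runs_Seq[where n' = "_ + 1"] runs_Seq runs_RAssign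
      runs_NAssign) (simp add: slot_def upd_apply j_def p_def)
qed


lemma runs_row:
  fixes N :: nstore and R :: rstore
  defines "M \<equiv> N ''M'' 0" and "o' \<equiv> N ''o'' 0"
  assumes post: "\<And>N' R'. (\<And>j. j \<le> M \<Longrightarrow>
        best_step w M (N ''l'' 0) (R ''F'') j (R' ''F'' j) (N' ''next'' (o' + j))) \<Longrightarrow>
      (\<And>q. q < o' \<Longrightarrow> N' ''next'' q = N ''next'' q) \<Longrightarrow>
      (\<And>u. u \<notin> {''i'', ''j'', ''next''} \<Longrightarrow> N' u = N u) \<Longrightarrow> Q (N', R')"
  shows "runs w row (N, R) ((1 + 1 + (5 * Suc M + 1) + 1 + 1 + 1 + 1) * Suc M + 1 + 1) Q"
proof -
  \<comment> \<open>The finished entries are measured against the initial array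
    \<open>R ''F''\<close>, not the current one. Cells of \<open>next\<close> below
    \<open>o'\<close> hold the rows of later layers and must survive.\<close>
  let ?J = "\<lambda>j N' R'. j \<le> Suc M \<and>
      (\<forall>j' < j. best_step w M (N ''l'' 0) (R ''F'') j' (R' ''F'' j') (N' ''next'' (o' + j'))) \<and>
      (\<forall>j' \<ge> j. R' ''F'' j' = R ''F'' j') \<and>
      (\<forall>q < o'. N' ''next'' q = N ''next'' q) \<and>
      (\<forall>u. u \<notin> {''i'', ''j'', ''next''} \<longrightarrow> N' u = N u)"
  define I where "I s \<longleftrightarrow> ?J (fst s ''j'' 0) (fst s) (snd s)" for s
  show ?thesis
    unfolding row_def
  proof (intro runs_Seq runs_NAssign, rule runs_While[where I = I and f = "\<lambda>s. Suc M - fst s ''j'' 0"])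
    show "I (upd (fst (N, R)) ''j'' (nval (fst (N, R)) (Num 0)) (nval (fst (N, R)) (Num 0)), snd (N, R))"
      by (simp add: I_def upd_apply)
    fix s assume I: "I s" and test: "holds w s (NLess (nvar ''j'') (NAdd (nvar ''M'') (Num 1)))"
    obtain N' R' where s: "s = (N', R')"
      by (cases s)
    let ?j = "N' ''j'' 0"
    have J: "?J ?j N' R'"
      using I by (simp add: I_def s)
    then have same: "N' ''M'' = N ''M''" "N' ''l'' = N ''l''" "N' ''o'' = N ''o''"
      by simp_all
    then have j: "?j \<le> M"
      using test by (simp add: s M_def)
    have "runs w row_body (N', R') (1 + 1 + (5 * Suc (N' ''M'' 0) + 1) + 1 + 1 + 1)
      (\<lambda>s'. I s' \<and> Suc M - fst s' ''j'' 0 < Suc M - ?j)"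
    proof (rule runs_row_body)
      show "?j \<le> N' ''M'' 0"
        using j same by (simp add: M_def)
      fix N'' R'' x y
      assume best: "best_step w (N' ''M'' 0) (N' ''l'' 0) (R' ''F'') ?j y x"
        and N'': "N'' ''j'' 0 = Suc ?j" "N'' ''next'' = (N' ''next'')(N' ''o'' 0 + ?j := x)"
        "\<And>u. u \<notin> {''i'', ''j'', ''next''} \<Longrightarrow> N'' u = N' u"
        and R'': "R'' ''F'' = (R' ''F'')(?j := y)"
      have best': "best_step w M (N ''l'' 0) (R ''F'') ?j y x"
        using best J same best_step_cong[of ?j M "R' ''F''" "R ''F''"] by (simp add: M_def)
      have "?J (Suc ?j) N'' R''"
        using J j best' N'' R'' same by (auto simp: o'_def less_Suc_eq)
      then show "I (N'', R'') \<and> Suc M - fst (N'', R'') ''j'' 0 < Suc M - ?j"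
        using N''(1) j by (simp add: I_def)
    qed
    then show "runs w row_body s (1 + 1 + (5 * Suc M + 1) + 1 + 1 + 1)
      (\<lambda>s'. I s' \<and> Suc M - fst s' ''j'' 0 < Suc M - fst s ''j'' 0)"
      using same by (simp add: s M_def)
  next
    fix s assume I: "I s" and test: "\<not> holds w s (NLess (nvar ''j'') (NAdd (nvar ''M'') (Num 1)))"
    obtain N' R' where s: "s = (N', R')"
      by (cases s)
    have J: "?J (N' ''j'' 0) N' R'"
      using I by (simp add: I_def s)
    then have "N' ''M'' = N ''M''"
      by simp
    then have "M < N' ''j'' 0"
      using test by (simp add: s M_def)
    then show "Q s"
      using J unfolding s by (intro post) auto
  qed (simp add: upd_apply)
qed


section \<open>The value function and the backward pass\<close>

text \<open>The largest weight from node \<open>(l, j)\<close> to the destination with at most \<open>c\<close> further layers. Nodes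
  \<open>(l, j)\<close> with \<open>j < l\<close>, which are not in the graph, get a value too; they are unreachable.\<close>

fun best :: "(edge \<Rightarrow> real) \<Rightarrow> nat \<Rightarrow> nat \<Rightarrow> nat \<Rightarrow> nat \<Rightarrow> real" where
  "best w M 0 l j = 0"
| "best w M (Suc c) l j =
     Max (insert 0 ((\<lambda>i. w (Layer l j, Layer (Suc l) i) + best w M c (Suc l) i) ` {j<..M}))"

lemma best_step_best:
  assumes "best_step w M l (best w M c (Suc l)) j y x"
  shows "y = best w M (Suc c) l j"
proof -
  have "best w M (Suc c) l j = y"
    unfolding best.simps
    by (rule Max_eqI) (use assms in \<open>auto simp: best_step_def\<close>)
  then show ?thesis
    by simp
qed

text \<open>One half of optimality: no path can beat \<open>best\<close>. Attainment comes from
  following the recorded successors in \<open>runs_read_path\<close>.\<close>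

lemma chain_le_best:
  assumes "l \<le> k" and "k \<le> l + c"
    and z: "\<And>i. i < k \<Longrightarrow> z i < z (Suc i)" "\<And>i. i \<le> k \<Longrightarrow> z i \<le> M"
  shows "(\<Sum>i = l..<k. w (Layer i (z i), Layer (Suc i) (z (Suc i)))) \<le> best w M c l (z l)"
  using assms(1,2)
proof (induction c arbitrary: l)
  case (Suc c)
  show ?case
  proof (cases "l = k")
    case True
    then show ?thesis
      by (simp add: Max_ge_iff)
  next
    case False
    with Suc.prems have l: "l < k"
      by simp
    let ?e = "\<lambda>i. w (Layer i (z i), Layer (Suc i) (z (Suc i)))"
    have "(\<Sum>i = l..<k. ?e i) = ?e l + (\<Sum>i = Suc l..<k. ?e i)"
      using l by (rule sum.atLeast_Suc_lessThan)
    also have "\<dots> \<le> ?e l + best w M c (Suc l) (z (Suc l))"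
      using Suc.IH[of "Suc l"] Suc.prems l by simp
    also have "\<dots> \<le> best w M (Suc c) l (z l)"
      unfolding best.simps using z(1)[of l] z(2)[of "Suc l"] l by (intro Max_ge) auto
    finally show ?thesis .
  qed
qed simp

text \<open>For want of multiplication, the successor of \<open>(l, j)\<close> is stored at \<open>(m - l) * (M + 1) + j\<close>: the
  offset grows by \<open>M + 1\<close> per layer and is \<open>0\<close> for the last layer, whose initial zeros
  already mean "stop".\<close>

definition rows_done ::
    "(edge \<Rightarrow> real) \<Rightarrow> nat \<Rightarrow> nat \<Rightarrow> nat \<Rightarrow> (nat \<Rightarrow> nat) \<Rightarrow> bool" where
  "rows_done w M m l nx \<longleftrightarrow> (\<forall>j \<le> M. nx j = 0) \<and>
     (\<forall>l'. l \<le> l' \<and> l' < m \<longrightarrow> (\<forall>j \<le> M. best_step w M l' (best w M (m - Suc l') (Suc l')) j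
        (best w M (m - l') l' j) (nx ((m - l') * Suc M + j))))"

text \<open>The rows of layers \<open>l\<close> to \<open>m\<close> fill the cells below
  \<open>Suc (m - l) * Suc M\<close>, so writing the row of an earlier layer does not disturb
  them.\<close>

lemma rows_done_cong:
  assumes "rows_done w M m l nx" and "\<And>q. q < Suc (m - l) * Suc M \<Longrightarrow> nx' q = nx q"
  shows "rows_done w M m l nx'"
proof -
  have "nx' ((m - l') * Suc M + j) = nx ((m - l') * Suc M + j)" if "l \<le> l'" "j \<le> M" for l' j
  proof (rule assms(2))
    have "(m - l') * Suc M \<le> (m - l) * Suc M"
      using that by (intro mult_le_mono) auto
    then show "(m - l') * Suc M + j < Suc (m - l) * Suc M"
      using that(2) by simp
  qed
  moreover have "nx' j = nx j" if "j \<le> M" for j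
    using that by (intro assms(2)) simp
  ultimately show ?thesis
    using assms(1) by (simp add: rows_done_def del: mult_Suc_right)
qed

lemma rows_done_Suc:
  assumes "rows_done w M m (Suc l) nx"
    and "\<And>j. j \<le> M \<Longrightarrow> best_step w M l (best w M (m - Suc l) (Suc l)) j
        (best w M (m - l) l j) (nx ((m - l) * Suc M + j))"
  shows "rows_done w M m l nx"
  unfolding rows_done_def
proof (intro conjI allI impI)
  fix l' j assume "l \<le> l' \<and> l' < m" and "j \<le> M"
  then show "best_step w M l' (best w M (m - Suc l') (Suc l')) j
      (best w M (m - l') l' j) (nx ((m - l') * Suc M + j))"
    using assms by (cases "l' = l") (auto simp: rows_done_def)
qed (use assms(1) in \<open>simp add: rows_done_def\<close>)

definition backward_body :: com where
  "backward_body = Seq (NAssign ''l'' (Num 0) (NSub (nvar ''l'') (Num 1)))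
     (Seq (NAssign ''o'' (Num 0) (NAdd (nvar ''o'') (NAdd (nvar ''M'') (Num 1)))) row)"

definition backward :: com where
  "backward = Seq (NAssign ''l'' (Num 0) (nvar ''m''))
     (While (NLess (Num 1) (nvar ''l'')) backward_body)"

definition row_time :: "nat \<Rightarrow> nat" where
  "row_time M = (1 + 1 + (5 * Suc M + 1) + 1 + 1 + 1 + 1) * Suc M + 1 + 1"

text \<open>The zeros in \<open>z\<close> and \<open>k\<close> are carried along because
  \<open>read_path\<close> starts from them.\<close>

definition backward_inv :: "(edge \<Rightarrow> real) \<Rightarrow> nat \<Rightarrow> nat \<Rightarrow> nat \<Rightarrow> state \<Rightarrow> bool" where
  "backward_inv w M m l s \<longleftrightarrow> 1 \<le> l \<and> l \<le> m \<and> fst s ''M'' 0 = M \<and> fst s ''l'' 0 = l \<and>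
     fst s ''o'' 0 = (m - l) * Suc M \<and> fst s ''z'' = (\<lambda>_. 0) \<and> fst s ''k'' = (\<lambda>_. 0) \<and>
     (\<forall>j \<le> M. snd s ''F'' j = best w M (m - l) l j) \<and> rows_done w M m l (fst s ''next'')"

lemma runs_backward_body:
  assumes "backward_inv w M m (Suc l) s" and "1 \<le> l"
  shows "runs w backward_body s (row_time M + 1 + 1) (backward_inv w M m l)"
proof -
  obtain N R where s: "s = (N, R)"
    by (cases s)
  let ?N = "upd (upd N ''l'' 0 l) ''o'' 0 ((m - l) * Suc M)"
  have I: "N ''M'' 0 = M" "N ''l'' 0 = Suc l" "N ''o'' 0 = (m - Suc l) * Suc M" "Suc l \<le> m"
      "N ''z'' = (\<lambda>_. 0)" "N ''k'' = (\<lambda>_. 0)" "rows_done w M m (Suc l) (N ''next'')"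
    and F: "\<And>j. j \<le> M \<Longrightarrow> R ''F'' j = best w M (m - Suc l) (Suc l) j"
    using assms(1) by (auto simp: backward_inv_def s)
  have ml: "m - l = Suc (m - Suc l)"
    using I(4) by simp
  have "runs w row (?N, R) ((1 + 1 + (5 * Suc (?N ''M'' 0) + 1) + 1 + 1 + 1 + 1) * Suc (?N ''M'' 0) + 1 + 1)
    (backward_inv w M m l)"
  proof (rule runs_row)
    fix N' R'
    assume row: "\<And>j. j \<le> ?N ''M'' 0 \<Longrightarrow> best_step w (?N ''M'' 0) (?N ''l'' 0) (R ''F'') j (R' ''F'' j)
        (N' ''next'' (?N ''o'' 0 + j))"
      and old: "\<And>q. q < ?N ''o'' 0 \<Longrightarrow> N' ''next'' q = ?N ''next'' q"
      and same: "\<And>u. u \<notin> {''i'', ''j'', ''next''} \<Longrightarrow> N' u = ?N u"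
    have step: "best_step w M l (best w M (m - Suc l) (Suc l)) j (R' ''F'' j)
        (N' ''next'' ((m - l) * Suc M + j))" if "j \<le> M" for j
      using row[of j] that I(1) best_step_cong[of j M "R ''F''" "best w M (m - Suc l) (Suc l)"] F
      by (simp add: upd_apply)
    then have F': "R' ''F'' j = best w M (m - l) l j" if "j \<le> M" for j
      unfolding ml using that by (intro best_step_best) (simp add: ml)
    have "rows_done w M m (Suc l) (N' ''next'')"
      using I(7) by (rule rows_done_cong) (use old ml in \<open>simp add: upd_apply\<close>)
    then have "rows_done w M m l (N' ''next'')"
      by (rule rows_done_Suc) (use step F' in simp)
    then show "backward_inv w M m l (N', R')"
      using F' same I assms(2) by (simp add: backward_inv_def upd_apply)
  qed
  then have "runs w row (?N, R) (row_time M) (backward_inv w M m l)"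
    by (simp add: row_time_def upd_apply I(1))
  moreover have "(m - Suc l) * Suc M + (M + 1) = (m - l) * Suc M"
    by (simp add: ml)
  ultimately show ?thesis
    unfolding backward_body_def s
    by (intro runs_Seq[where n' = "_ + 1"] runs_Seq runs_NAssign) (simp add: upd_apply I(1-3))
qed

lemma runs_backward:
  assumes "1 \<le> m"
  shows "runs w backward (input_state M m) ((row_time M + 1 + 1 + 1) * m + 1 + 1) (backward_inv w M m 1)"
proof -
  let ?I = "\<lambda>s. backward_inv w M m (fst s ''l'' 0) s"
  let ?N = "upd (fst (input_state M m)) ''l'' 0 m"
  have "runs w (While (NLess (Num 1) (nvar ''l'')) backward_body) (?N, \<lambda>_ _. 0)
     ((row_time M + 1 + 1 + 1) * m + 1) (backward_inv w M m 1)"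
  proof (rule runs_While[where I = ?I and f = "\<lambda>s. fst s ''l'' 0"])
    \<comment> \<open>In the last layer stopping is the only option, so the zero-initialised
      \<open>F\<close>, \<open>next\<close> and \<open>o\<close> are already correct there.\<close>
    show "?I (?N, \<lambda>_ _. 0)"
      using assms by (auto simp: backward_inv_def rows_done_def input_state_def upd_apply)
    fix s assume I: "?I s"
    {
      assume "holds w s (NLess (Num 1) (nvar ''l''))"
      then obtain l where l: "fst s ''l'' 0 = Suc l" "1 \<le> l"
        by (cases "fst s ''l'' 0") auto
      show "runs w backward_body s (row_time M + 1 + 1)
          (\<lambda>s'. ?I s' \<and> fst s' ''l'' 0 < fst s ''l'' 0)"
        using I l by (intro runs_mono[OF runs_backward_body[of w M m l s]]) (auto simp: backward_inv_def)
    next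
      assume "\<not> holds w s (NLess (Num 1) (nvar ''l''))"
      moreover have "1 \<le> fst s ''l'' 0"
        using I by (simp add: backward_inv_def)
      ultimately have "fst s ''l'' 0 = 1"
        by simp
      then show "backward_inv w M m 1 s"
        using I by simp
    }
  qed (simp add: upd_apply)
  then show ?thesis
    unfolding backward_def by (intro runs_Seq runs_NAssign) (simp add: input_state_def upd_apply)
qed


section \<open>The source, and reading off a maximum weight path\<close>

text \<open>At the source stopping is not allowed, so the scan starts from the successor \<open>1\<close> instead of
  \<open>0\<close>.\<close>

definition first_layer :: com where
  "first_layer = Seq (NAssign ''l'' (Num 0) (Num 0)) (Seq (NAssign ''j'' (Num 0) (Num 0))
     (Seq (NAssign ''o'' (Num 0) (NAdd (nvar ''o'') (NAdd (nvar ''M'') (Num 1))))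
     (Seq (NAssign ''i'' (Num 0) (Num 1)) (Seq (RAssign ''b'' (Num 0) candidate)
     (Seq (NAssign ''next'' slot (Num 1)) (Seq (NAssign ''i'' (Num 0) (Num 2)) scan))))))"

definition first_inv :: "(edge \<Rightarrow> real) \<Rightarrow> nat \<Rightarrow> nat \<Rightarrow> real \<Rightarrow> state \<Rightarrow> bool" where
  "first_inv w M m y s \<longleftrightarrow> fst s ''M'' 0 = M \<and> fst s ''o'' 0 = m * Suc M \<and>
     fst s ''z'' = (\<lambda>_. 0) \<and> fst s ''k'' = (\<lambda>_. 0) \<and> rows_done w M m 1 (fst s ''next'') \<and>
     (\<forall>i. 1 \<le> i \<and> i \<le> M \<longrightarrow> w (Layer 0 0, Layer 1 i) + best w M (m - 1) 1 i \<le> y) \<and>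
     (\<exists>x. fst s ''next'' (m * Suc M) = x \<and> 1 \<le> x \<and> x \<le> M \<and>
        y = w (Layer 0 0, Layer 1 x) + best w M (m - 1) 1 x)"

lemma runs_first_layer:
  assumes "backward_inv w M m 1 s" and "1 \<le> M"
  shows "runs w first_layer s (5 * Suc M + 1 + 1 + 1 + 1 + 1 + 1 + 1 + 1) (\<lambda>s'. \<exists>y. first_inv w M m y s')"
proof -
  obtain N R where s: "s = (N, R)"
    by (cases s)
  let ?g = "\<lambda>i. w (Layer 0 0, Layer 1 i) + best w M (m - 1) 1 i"
  let ?N1 = "upd (upd (upd N ''l'' 0 0) ''j'' 0 0) ''o'' 0 (m * Suc M)"
  let ?N = "upd (upd (upd ?N1 ''i'' 0 1) ''next'' (m * Suc M) 1) ''i'' 0 2"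
    and ?R = "upd R ''b'' 0 (?g 1)"
  have I: "N ''M'' 0 = M" "N ''o'' 0 = (m - 1) * Suc M" "1 \<le> m"
      "N ''z'' = (\<lambda>_. 0)" "N ''k'' = (\<lambda>_. 0)" "rows_done w M m 1 (N ''next'')"
    and F: "\<And>j. j \<le> M \<Longrightarrow> R ''F'' j = best w M (m - 1) 1 j"
    using assms(1) by (auto simp: backward_inv_def s)
  have o: "(m - 1) * Suc M + (M + 1) = m * Suc M"
    using I(3) by (cases m) auto
  have "runs w scan (?N, ?R) (5 * Suc (?N ''M'' 0) + 1) (\<lambda>s'. \<exists>y. first_inv w M m y s')"
  proof (rule runs_scan)
    show "?N ''i'' 0 \<le> Suc (?N ''M'' 0)"
      using assms(2) I(1) by (simp add: upd_apply)
    fix i x y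
    let ?p = "?N ''o'' 0 + ?N ''j'' 0"
    let ?h = "\<lambda>i. w (Layer (?N ''l'' 0) (?N ''j'' 0), Layer (Suc (?N ''l'' 0)) i) + ?R ''F'' i"
    assume "?R ''b'' 0 \<le> y"
      and "\<And>i. ?N ''i'' 0 \<le> i \<Longrightarrow> i \<le> ?N ''M'' 0 \<Longrightarrow> ?h i \<le> y"
      and "x = ?N ''next'' ?p \<and> y = ?R ''b'' 0 \<or>
        ?N ''i'' 0 \<le> x \<and> x \<le> ?N ''M'' 0 \<and> y = ?h x"
    then have y: "?g 1 \<le> y" "\<And>i. 2 \<le> i \<Longrightarrow> i \<le> M \<Longrightarrow> ?g i \<le> y"
      and x: "x = 1 \<and> y = ?g 1 \<or> 2 \<le> x \<and> x \<le> M \<and> y = ?g x"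
      using I(1) F by (auto simp: upd_apply)
    have "?g i \<le> y" if "1 \<le> i" "i \<le> M" for i
      using y that by (cases "i = 1") auto
    moreover have "1 \<le> x" "x \<le> M" "y = ?g x"
      using x assms(2) by auto
    \<comment> \<open>The source uses the cell \<open>m * Suc M\<close>, the first one after the
      rows of all layers.\<close>
    moreover have "rows_done w M m 1 ((N ''next'')(m * Suc M := x))"
      using I(6) by (rule rows_done_cong) (use I(3) in simp)
    ultimately have "first_inv w M m y (upd (upd ?N ''i'' 0 i) ''next'' ?p x, upd ?R ''b'' 0 y)"
      using I by (auto simp: first_inv_def upd_apply)
    then show "\<exists>y'. first_inv w M m y' (upd (upd ?N ''i'' 0 i) ''next'' ?p x, upd ?R ''b'' 0 y)"
      by blast
  qed
  then have scan: "runs w scan (?N, ?R) (5 * Suc M + 1) (\<lambda>s'. \<exists>y. first_inv w M m y s')"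
    by (simp add: upd_apply I(1))
  have "rval w (upd ?N1 ''i'' 0 1, R) candidate = ?g 1"
    using F assms(2) by (simp add: candidate_def upd_apply)
  with scan o show ?thesis
    unfolding first_layer_def s
    by (intro runs_Seq runs_NAssign runs_RAssign) (simp add: upd_apply slot_def I(1,2))
qed

definition read_path_body :: com where
  "read_path_body = Seq
     (NAssign ''z'' (NAdd (nvar ''k'') (Num 1))
       (NArr ''next'' (NAdd (nvar ''o'') (NArr ''z'' (nvar ''k'')))))
     (Seq (NAssign ''k'' (Num 0) (NAdd (nvar ''k'') (Num 1)))
       (NAssign ''o'' (Num 0) (NSub (nvar ''o'') (NAdd (nvar ''M'') (Num 1)))))"

text \<open>A recorded successor exceeds the position of its node and is thus positive, so 0 is free
  to signal a stop. No test against \<open>m\<close> is made: the row of layer \<open>m\<close>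
  consists of zeros.\<close>

definition read_path :: com where
  "read_path = While (NLess (Num 0) (NArr ''next'' (NAdd (nvar ''o'') (NArr ''z'' (nvar ''k'')))))
     read_path_body"

lemma runs_read_path:
  assumes "first_inv w M m y s" and "1 \<le> m"
  shows "runs w read_path s ((1 + 1 + 1 + 1) * m + 1) (\<lambda>s'. 1 \<le> fst s' ''k'' 0 \<and> fst s' ''k'' 0 \<le> m \<and>
     positions M (fst s' ''k'' 0) (fst s' ''z'') \<and>
     (\<Sum>l < fst s' ''k'' 0. w (Layer l (fst s' ''z'' l), Layer (Suc l) (fst s' ''z'' (Suc l)))) = y)"
proof -
  let ?nx = "fst s ''next''"
  let ?e = "\<lambda>z l. w (Layer l (z l), Layer (Suc l) (z (Suc l)))"
  \<comment> \<open>The best value still obtainable. At the source it is \<open>y\<close> and not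
    \<open>best\<close>, which would allow an immediate stop of value 0. The weight read so far plus
    \<open>V\<close> stays equal to \<open>y\<close>.\<close>
  define V where "V k j = (if k = 0 then y else best w M (m - k) k j)" for k j
  let ?J = "\<lambda>k z s'. k \<le> m \<and> positions M k z \<and> (\<Sum>l<k. ?e z l) + V k (z k) = y \<and>
     fst s' ''M'' 0 = M \<and> fst s' ''o'' 0 = (m - k) * Suc M \<and> fst s' ''next'' = ?nx"
  define I where "I s' \<longleftrightarrow> ?J (fst s' ''k'' 0) (fst s' ''z'') s'" for s' :: state
  define x where "x k j = ?nx ((m - k) * Suc M + j)" for k j
  \<comment> \<open>Each recorded entry either stops where nothing more can be gained or names a
    successor that attains \<open>V\<close>.\<close>
  have choice: "1 \<le> k \<and> x k (z k) = 0 \<and> V k (z k) = 0 \<or>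
      k < m \<and> z k < x k (z k) \<and> x k (z k) \<le> M \<and>
      V k (z k) = w (Layer k (z k), Layer (Suc k) (x k (z k))) + V (Suc k) (x k (z k))"
    if "k \<le> m" and z: "positions M k z" for k z
  proof -
    have z_le: "z k \<le> M" and z0: "z 0 = 0"
      using z by (auto simp: positions_def)
    consider "k = 0" | "k = m" "1 \<le> k" | "1 \<le> k" "k < m"
      using \<open>k \<le> m\<close> by linarith
    then show ?thesis
    proof cases
      case 1
      then show ?thesis
        using assms z0 by (auto simp: first_inv_def V_def x_def)
    next
      case 2
      then show ?thesis
        using assms(1) z_le by (simp add: first_inv_def rows_done_def V_def x_def)
    next
      case 3
      then have "best_step w M k (best w M (m - Suc k) (Suc k)) (z k)
          (best w M (m - k) k (z k)) (x k (z k))"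
        using assms(1) z_le unfolding x_def first_inv_def rows_done_def by blast
      then show ?thesis
        using 3 by (auto simp: best_step_def V_def)
    qed
  qed
  show ?thesis
    unfolding read_path_def
  proof (rule runs_While[where I = I and f = "\<lambda>s. m - fst s ''k'' 0"])
    show "I s"
      using assms(1) by (simp add: I_def first_inv_def positions_def V_def)
    fix s' assume "I s'"
    obtain N R where s': "s' = (N, R)"
      by (cases s')
    let ?k = "N ''k'' 0" and ?z = "N ''z''"
    let ?x = "x ?k (?z ?k)"
    have J: "?k \<le> m" "positions M ?k ?z" "(\<Sum>l<?k. ?e ?z l) + V ?k (?z ?k) = y"
        "N ''M'' 0 = M" "N ''o'' 0 = (m - ?k) * Suc M" "N ''next'' = ?nx"
      using \<open>I s'\<close> by (auto simp: I_def s')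
    have x: "N ''next'' (N ''o'' 0 + ?z ?k) = ?x"
      by (simp only: x_def J(5,6))
    {
      assume "holds w s' (NLess (Num 0) (NArr ''next'' (NAdd (nvar ''o'') (NArr ''z'' (nvar ''k'')))))"
      then have "?x > 0"
        by (simp add: s' x)
      then have k: "?k < m" and step: "?z ?k < ?x" "?x \<le> M"
          "V ?k (?z ?k) = w (Layer ?k (?z ?k), Layer (Suc ?k) ?x) + V (Suc ?k) ?x"
        using choice[OF J(1,2)] by auto
      let ?z' = "?z(Suc ?k := ?x)"
      let ?N = "upd (upd (upd N ''z'' (Suc ?k) ?x) ''k'' 0 (Suc ?k)) ''o'' 0 ((m - Suc ?k) * Suc M)"
      have "positions M (Suc ?k) ?z'"
        using J(2) step by (auto simp: positions_def less_Suc_eq)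
      moreover have "(\<Sum>l<Suc ?k. ?e ?z' l) + V (Suc ?k) (?z' (Suc ?k)) = y"
        using J(3) step(3) by simp
      ultimately have "I (?N, R)"
        using k J by (simp add: I_def upd_apply)
      \<comment> \<open>The truncated subtraction is exact because \<open>?k < m\<close>.\<close>
      moreover have "(m - ?k) * Suc M - (M + 1) = (m - Suc ?k) * Suc M"
        using k by (simp add: diff_mult_distrib flip: Suc_diff_Suc)
      ultimately show "runs w read_path_body s' (1 + 1 + 1)
          (\<lambda>s''. I s'' \<and> m - fst s'' ''k'' 0 < m - fst s' ''k'' 0)"
        unfolding read_path_body_def s' using k x J(4,5) diff_less_mono2[OF lessI k]
        by (intro runs_Seq runs_NAssign) (simp add: upd_apply)
    next
      assume "\<not> holds w s' (NLess (Num 0) (NArr ''next'' (NAdd (nvar ''o'') (NArr ''z'' (nvar ''k'')))))"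
      then have "?x = 0"
        by (simp add: s' x)
      then show "1 \<le> fst s' ''k'' 0 \<and> fst s' ''k'' 0 \<le> m \<and>
          positions M (fst s' ''k'' 0) (fst s' ''z'') \<and> (\<Sum>l < fst s' ''k'' 0. ?e (fst s' ''z'') l) = y"
        using choice[OF J(1,2)] J by (simp add: s')
    }
  qed simp
qed

definition max_path_program :: com where
  "max_path_program = Seq backward (Seq first_layer read_path)"

lemma path_weight_le_first:
  assumes "first_inv w M m y s" and w: "\<forall>u. w (u, Dest) = 0" and "p \<in> sd_paths M m"
  shows "path_weight w p \<le> y"
proof -
  obtain z k where p: "p = layer_path z k" and k: "1 \<le> k" "k \<le> m" and z: "positions M k z"
    using assms(3) by (auto simp: sd_paths_eq)
  let ?e = "\<lambda>l. w (Layer l (z l), Layer (Suc l) (z (Suc l)))"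
  have "path_weight w p = (\<Sum>l = 0..<k. ?e l)"
    by (simp add: p path_weight_layer_path w atLeast0LessThan)
  also have "\<dots> = ?e 0 + (\<Sum>l = 1..<k. ?e l)"
    using k(1) by (simp add: sum.atLeast_Suc_lessThan)
  also have "\<dots> \<le> ?e 0 + best w M (m - 1) 1 (z 1)"
    using chain_le_best[of 1 k "m - 1" z M w] k positions_less[OF z] positions_le[OF z] by simp
  also have "\<dots> \<le> y"
  proof -
    have "z 0 = 0" "1 \<le> z 1" "z 1 \<le> M"
      using k(1) z positions_ge[OF z, of 1] positions_le[OF z, of 1] by (simp_all add: positions_def)
    moreover have "\<forall>i. 1 \<le> i \<and> i \<le> M \<longrightarrow> w (Layer 0 0, Layer 1 i) + best w M (m - 1) 1 i \<le> y"
      using assms(1) unfolding first_inv_def by blast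
    ultimately show ?thesis
      by simp
  qed
  finally show ?thesis .
qed

lemma runs_max_path_program:
  assumes "1 \<le> M" and "1 \<le> m" and w: "\<forall>u. w (u, Dest) = 0"
  shows "runs w max_path_program (input_state M m) (40 * (m + M) ^ 3)
    (\<lambda>s. is_arg_max (path_weight w) (\<lambda>p. p \<in> sd_paths M m) (output_path s))"
proof -
  let ?Q = "\<lambda>s. is_arg_max (path_weight w) (\<lambda>p. p \<in> sd_paths M m) (output_path s)"
  have Q: "?Q s'" if "first_inv w M m y s" and k: "1 \<le> fst s' ''k'' 0" "fst s' ''k'' 0 \<le> m"
    and z: "positions M (fst s' ''k'' 0) (fst s' ''z'')"
    and y: "(\<Sum>l < fst s' ''k'' 0. w (Layer l (fst s' ''z'' l), Layer (Suc l) (fst s' ''z'' (Suc l)))) = y"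
    for y s s'
  proof -
    have "path_weight w (output_path s') = y"
      using y w by (simp add: output_path_def path_weight_layer_path)
    moreover have "output_path s' \<in> sd_paths M m"
      unfolding output_path_def using k z by (rule layer_path_in_sd_paths)
    ultimately show ?thesis
      using path_weight_le_first[OF that(1) w] by (simp add: is_arg_max_linorder)
  qed
  let ?t1 = "(row_time M + 1 + 1 + 1) * m + 1 + 1"
    and ?t2 = "5 * Suc M + 1 + 1 + 1 + 1 + 1 + 1 + 1 + 1"
    and ?t3 = "(1 + 1 + 1 + 1) * m + 1"
  have read_path: "runs w read_path s ?t3 ?Q" if "first_inv w M m y s" for y s
    by (rule runs_mono[OF runs_read_path[OF that assms(2)] order_refl]) (use Q[OF that] in blast)
  have "runs w max_path_program (input_state M m) (?t3 + ?t2 + ?t1) ?Q"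
    unfolding max_path_program_def
  proof (rule runs_Seq, rule runs_mono[OF runs_backward[OF assms(2)] order_refl], rule runs_Seq)
    fix s assume "backward_inv w M m 1 s"
    from runs_first_layer[OF this assms(1)]
    show "runs w first_layer s ?t2 (\<lambda>s'. runs w read_path s' ?t3 ?Q)"
      by (rule runs_mono[OF _ order_refl]) (use read_path in blast)
  qed
  moreover have "?t3 + ?t2 + ?t1 \<le> 40 * (m + M) ^ 3"
  proof -
    \<comment> \<open>As \<open>m\<close> is at least 1, \<open>S\<close> bounds
      \<open>Suc M\<close> as well as \<open>m\<close>.\<close>
    define S where "S = m + M"
    have S: "Suc M \<le> S" "m \<le> S" "1 \<le> S"
      using assms by (auto simp: S_def)
    have sq: "1 \<le> S * S" "S * S \<le> S ^ 3" "S \<le> S * S"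
      using S(3) by (auto simp: power3_eq_cube)
    have "row_time M = (5 * Suc M + 7) * Suc M + 2"
      by (simp add: row_time_def)
    also have "\<dots> \<le> (12 * S) * S + 2"
      using S by (intro add_mono mult_le_mono) auto
    also have "\<dots> = 12 * (S * S) + 2"
      by simp
    \<comment> \<open>The constants 2 and 3 are absorbed into \<open>5 * (S * S)\<close>, which
      makes 12 into 17.\<close>
    finally have "row_time M + 3 \<le> 17 * (S * S)"
      using sq(1) by linarith
    then have "(row_time M + 3) * m \<le> 17 * (S * S) * S"
      using S(2) by (rule mult_le_mono)
    then have cube: "(row_time M + 3) * m \<le> 17 * S ^ 3"
      by (simp add: power3_eq_cube mult.assoc)
    \<comment> \<open>All terms together need 17 + 4 + 5 + 11 = 37 times \<open>c\<close>; 40 is a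
      round number above this.\<close>
    have bound: "P + 4 * m + 5 * n + 11 \<le> 40 * c"
      if "P \<le> 17 * c" "n \<le> S" "S \<le> q" "q \<le> c" for P n q c
      using that S(2,3) by linarith
    have "?t3 + ?t2 + ?t1 = (row_time M + 3) * m + 4 * m + 5 * Suc M + 11"
      by (simp add: algebra_simps)
    then show ?thesis
      using bound[OF cube S(1) sq(3,2)] by (simp only: S_def)
  qed
  ultimately show ?thesis
    by (rule runs_mono)
qed

lemma max_path_polynomial_time:
  "\<exists>c C d. \<forall>M m w. 1 \<le> M \<and> 1 \<le> m \<and> (\<forall>u. w (u, Dest) = 0) \<longrightarrow>
     (\<exists>n s. exec w c (input_state M m) n s \<and> n \<le> C * (m + M) ^ d \<and>
        is_arg_max (path_weight w) (\<lambda>p. p \<in> sd_paths M m) (output_path s))"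
  using runs_max_path_program unfolding runs_def by metis

theorem mainTheorem3:
  fixes K M T m :: nat and v :: "nat \<Rightarrow> real" and B :: "nat \<Rightarrow> real list"
  assumes "1 \<le> M" and "M \<le> K" and "1 \<le> m"
    and "\<forall>i j. 1 \<le> i \<and> i \<le> j \<and> j \<le> M \<longrightarrow> v j \<le> v i" and "v M > 0"
    and "\<forall>t \<in> {1..T}. K \<le> length (B t)"
  shows
    "bij_betw (path_strategy v) (sd_paths M m) (Pbar_weak v M m) \<and>
     (\<forall>p \<in> sd_paths M m. strategy_path (path_strategy v p) = p) \<and>
     (\<forall>b \<in> Pbar_weak v M m. path_strategy v (strategy_path b) = b) \<and>
     Pbar v M m \<subseteq> Pbar_weak v M m \<and>
     bid_vector ` Pbar v M m = bid_vector ` Pbar_weak v M m \<and>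
     (bij_betw (path_strategy v) (sd_paths M m) (Pbar v M m) \<longleftrightarrow>
        m = 1 \<or> inj_on (avg v) {1..M}) \<and>
     (\<forall>P \<in> {Pbar v M m, Pbar_weak v M m}.
        (\<forall>b \<in> P. total_value K T v B b = path_weight (edge_weight K T v B) (strategy_path b)) \<and>
        finite P \<and> P \<noteq> {} \<and> finite (sd_paths M m) \<and> sd_paths M m \<noteq> {} \<and>
        Max (total_value K T v B ` P) = Max (path_weight (edge_weight K T v B) ` sd_paths M m) \<and>
        (\<forall>b \<in> P. is_arg_max (total_value K T v B) (\<lambda>b. b \<in> P) b \<longleftrightarrow>
           is_arg_max (path_weight (edge_weight K T v B)) (\<lambda>p. p \<in> sd_paths M m)
             (strategy_path b))) \<and>
     (\<exists>c C d. \<forall>M' m' w. 1 \<le> M' \<and> 1 \<le> m' \<and> (\<forall>u. w (u, Dest) = 0) \<longrightarrow>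
        (\<exists>n s. exec w c (input_state M' m') n s \<and> n \<le> C * (m' + M') ^ d \<and>
           is_arg_max (path_weight w) (\<lambda>p. p \<in> sd_paths M' m') (output_path s)))"
proof (intro conjI)
  show "bij_betw (path_strategy v) (sd_paths M m) (Pbar_weak v M m)"
    using assms(4,5) by (rule bij_betw_path_strategy)
  show "\<forall>p \<in> sd_paths M m. strategy_path (path_strategy v p) = p"
    using strategy_path_path_strategy by (auto simp: sd_paths_eq)
  show "\<forall>b \<in> Pbar_weak v M m. path_strategy v (strategy_path b) = b"
    unfolding Pbar_weak_def using path_strategy_strategy_path by blast
  show "Pbar v M m \<subseteq> Pbar_weak v M m"
    by (rule Pbar_subset_Pbar_weak)
  show "bid_vector ` Pbar v M m = bid_vector ` Pbar_weak v M m"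
    by (rule bid_vector_image_Pbar)
  \<comment> \<open>The image of \<open>path_strategy v\<close> on all paths is
    \<open>Pbar_weak v M m\<close>, so it is onto \<open>Pbar v M m\<close> only if the two sets
    agree.\<close>
  have "bij_betw (path_strategy v) (sd_paths M m) (Pbar v M m) \<longleftrightarrow> Pbar v M m = Pbar_weak v M m"
    using bij_betw_path_strategy[OF assms(4,5), of m] by (auto simp: bij_betw_def)
  then show "bij_betw (path_strategy v) (sd_paths M m) (Pbar v M m) \<longleftrightarrow>
      m = 1 \<or> inj_on (avg v) {1..M}"
    using Pbar_eq_Pbar_weak_iff[OF assms(4,5,3)] by simp
  show "\<forall>P \<in> {Pbar v M m, Pbar_weak v M m}.
      (\<forall>b \<in> P. total_value K T v B b = path_weight (edge_weight K T v B) (strategy_path b)) \<and>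
      finite P \<and> P \<noteq> {} \<and> finite (sd_paths M m) \<and> sd_paths M m \<noteq> {} \<and>
      Max (total_value K T v B ` P) = Max (path_weight (edge_weight K T v B) ` sd_paths M m) \<and>
      (\<forall>b \<in> P. is_arg_max (total_value K T v B) (\<lambda>b. b \<in> P) b \<longleftrightarrow>
         is_arg_max (path_weight (edge_weight K T v B)) (\<lambda>p. p \<in> sd_paths M m)
           (strategy_path b))"
    (is "\<forall>P \<in> _. ?C P")
  proof
    fix P assume P: "P \<in> {Pbar v M m, Pbar_weak v M m}"
    show "?C P"
      using values_and_paths[OF assms P] finite_sd_paths sd_paths_nonempty[OF assms(1,3)]
      by (intro conjI)
  qed
  show "\<exists>c C d. \<forall>M' m' w. 1 \<le> M' \<and> 1 \<le> m' \<and> (\<forall>u. w (u, Dest) = 0) \<longrightarrow>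
      (\<exists>n s. exec w c (input_state M' m') n s \<and> n \<le> C * (m' + M') ^ d \<and>
         is_arg_max (path_weight w) (\<lambda>p. p \<in> sd_paths M' m') (output_path s))"
    by (rule max_path_polynomial_time)
qed

end
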